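(* Let $f \in L^1(\mathbb{R},\mathrm{Leb})$ be a real-valued function satisfying the following two assumptions: (1) $f_{k_0} \in L^\infty(\mathbb{R},\mathrm{Leb})$ for some $k_0\in\mathbb{N}$; (2) $\int_\mathbb{R} |x|^\epsilon |f(x)| \, \mathrm{d} x < \infty$ for some $\epsilon > 0$. Then there exists $k_1 \in \mathbb{N}$ such that for every $k\ge k_1$ the function $x \mapsto (1+|x|^\epsilon) f_k(x)$ is bounded, continuous and directly Riemann integrable. In particular, $f_k$ itself is bounded, continuous and directly Riemann integrable for every $k\ge k_1$.
   Context: For $f\in L^1(\mathbb{R})$, the convolution powers are defined by $f_1 := f$ and $f_{k+1}(x) := (f_k * f)(x) = \int_\mathbb{R} f_k(x-y) f(y)\,\mathrm{d}y$ for $k\in\mathbb{N}$. A non-negative function $g:\mathbb{R}\to[0,\infty)$ is called directly Riemann integrable (d.R.i.) if $$\lim_{\delta\downarrow 0}\sum_{m\in\mathbb{Z}}\delta\Big(\sup_{z\in[m\delta,(m+1)\delta)} g(z)\Big)=\lim_{\delta\downarrow 0}\sum_{m\in\mathbb{Z}}\delta\Big(\inf_{z\in[m\delta,(m+1)\delta)} g(z)\Big)\in(-\infty,\infty),$$ i.e. both limits exist, are finite and coincide. A real-valued function $g$ is d.R.i. if both its positive part $g^+$ and negative part $g^-$ are d.R.i. *)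

theory Defs
  imports "HOL-Analysis.Analysis"
begin

text \<open>Convolution powers: conv_power f k is f_k for k >= 1 (index 0 is unused, set to 0).
  f_1 = f and f_(k+1) x = integral over y of f_k (x - y) * f y (Lebesgue/Bochner integral).\<close>
fun conv_power :: "(real \<Rightarrow> real) \<Rightarrow> nat \<Rightarrow> real \<Rightarrow> real" where
  "conv_power f 0 = (\<lambda>_. 0)"
| "conv_power f (Suc 0) = f"
| "conv_power f (Suc (Suc k)) = (\<lambda>x. LINT y|lborel. conv_power f (Suc k) (x - y) * f y)"

definition upper_riemann_sum :: "(real \<Rightarrow> real) \<Rightarrow> real \<Rightarrow> ennreal" where
  "upper_riemann_sum g \<delta> =
     (\<integral>\<^sup>+ m. ennreal \<delta> * (SUP z\<in>{real_of_int m * \<delta> ..< (real_of_int m + 1) * \<delta>}. ennreal (g z))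
        \<partial>count_space (UNIV :: int set))"

definition lower_riemann_sum :: "(real \<Rightarrow> real) \<Rightarrow> real \<Rightarrow> ennreal" where
  "lower_riemann_sum g \<delta> =
     (\<integral>\<^sup>+ m. ennreal \<delta> * (INF z\<in>{real_of_int m * \<delta> ..< (real_of_int m + 1) * \<delta>}. ennreal (g z))
        \<partial>count_space (UNIV :: int set))"

definition dRi_nonneg :: "(real \<Rightarrow> real) \<Rightarrow> bool" where
  "dRi_nonneg g \<longleftrightarrow> (\<forall>x. 0 \<le> g x) \<and>
     (\<exists>L::real. ((upper_riemann_sum g) \<longlongrightarrow> ennreal L) (at_right 0) \<and>
                ((lower_riemann_sum g) \<longlongrightarrow> ennreal L) (at_right 0))"

definition dRi :: "(real \<Rightarrow> real) \<Rightarrow> bool" where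
  "dRi g \<longleftrightarrow> dRi_nonneg (\<lambda>x. max (g x) 0) \<and> dRi_nonneg (\<lambda>x. max (- g x) 0)"

end

theory Submission
  imports Defs
begin

text \<open>
  Let \<open>H\<close> be the truncation of \<open>\<bar>f\<^sub>k\<^sub>0\<bar>\<close> at its essential bound and let
  \<open>W x = (1 + \<bar>x\<bar>)\<^sup>\<epsilon>\<close>.  For large \<open>k\<close>, \<open>\<bar>f\<^sub>k\<bar>\<close> is dominated by \<open>P * R\<close>, where \<open>P\<close> is a high convolution
  power of \<open>H\<close> and \<open>R\<close> is a convolution power of \<open>\<bar>f\<bar>\<close>, which has a finite \<open>W\<close>-moment.  What has to be
  shown is that \<open>W P\<close> lies in the Wiener amalgam space of functions whose suprema over unit cells
  are summable: this space is stable under convolution with integrable functions, and its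
  continuous elements are bounded and, by dominated convergence, directly Riemann integrable.
  Continuity itself comes from convolving a bounded function with an integrable one.

  If a sum of \<open>n + 2\<close> numbers is \<open>x\<close>, one may use the boundedness of \<open>H\<close> on the smallest summand:
  splitting according to the size \<open>s\<close> of that summand, the cell suprema sum up to \<open>O(s)\<close> times the
  \<open>(n + 1)\<close>-st power of the tail integral of \<open>H\<close> beyond \<open>s\<close>, which is \<open>O(s\<^sup>-\<^sup>\<epsilon>)\<close> by the moment condition.
  For large \<open>n\<close> the sum over \<open>s\<close> converges.  The weight is absorbed by one further factor,
  since \<open>W (y + z) \<le> 2\<^sup>\<epsilon> (W y + W z)\<close>.
\<close>

subsection \<open>Convolution of non-negative functions and the amalgam norm\<close>

text \<open>Values in \<open>ennreal\<close> keep Fubini and monotonicity free of integrability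
  conditions. Signed convolution powers are compared with \<open>nconv\<close> through absolute
  values.\<close>

definition nconv :: "(real \<Rightarrow> ennreal) \<Rightarrow> (real \<Rightarrow> ennreal) \<Rightarrow> real \<Rightarrow> ennreal"
  where "nconv u v x = (\<integral>\<^sup>+ y. u (x - y) * v y \<partial>lborel)"

text \<open>Exponents are shifted: \<open>nconv_power u n\<close> has \<open>n + 1\<close> factors.\<close>

primrec nconv_power :: "(real \<Rightarrow> ennreal) \<Rightarrow> nat \<Rightarrow> real \<Rightarrow> ennreal" where
  "nconv_power u 0 = u"
| "nconv_power u (Suc n) = nconv (nconv_power u n) u"

text \<open>Stated for a composition with \<open>g\<close>, so that \<open>nconv u v (x - y)\<close>
  under a further integral is recognised as measurable.\<close>

lemma borel_measurable_nconv [measurable (raw)]: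
  assumes [measurable]: "u \<in> borel_measurable borel" "v \<in> borel_measurable borel"
    "g \<in> borel_measurable M"
  shows "(\<lambda>x. nconv u v (g x)) \<in> borel_measurable M"
proof -
  have "nconv u v \<in> borel_measurable borel"
    unfolding nconv_def[abs_def] by measurable
  from measurable_compose[OF assms(3) this] show ?thesis .
qed

lemma borel_measurable_nconv_power [measurable]:
  assumes [measurable]: "u \<in> borel_measurable borel"
  shows "nconv_power u n \<in> borel_measurable borel"
  by (induction n) simp_all

lemma nn_integral_reflect:
  fixes x :: real
  assumes [measurable]: "h \<in> borel_measurable borel"
  shows "(\<integral>\<^sup>+ y. h (x - y) \<partial>lborel) = (\<integral>\<^sup>+ y. h y \<partial>lborel)"
  using nn_integral_real_affine[of h "-1" x] by simp

lemma nn_integral_translate: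
  fixes x :: real
  assumes [measurable]: "h \<in> borel_measurable borel"
  shows "(\<integral>\<^sup>+ y. h (y - x) \<partial>lborel) = (\<integral>\<^sup>+ y. h y \<partial>lborel)"
  using nn_integral_real_affine[of h "1" "-x"] by simp

lemma nconv_commute:
  assumes [measurable]: "u \<in> borel_measurable borel" "v \<in> borel_measurable borel"
  shows "nconv u v = nconv v u"
proof
  fix x
  have "nconv v u x = (\<integral>\<^sup>+ y. (\<lambda>z. u (x - z) * v z) (x - y) \<partial>lborel)"
    unfolding nconv_def by (simp add: mult.commute)
  also have "\<dots> = nconv u v x"
    unfolding nconv_def by (subst nn_integral_reflect) simp_all
  finally show "nconv u v x = nconv v u x" ..
qed

lemma nconv_assoc:
  assumes [measurable]: "u \<in> borel_measurable borel" "v \<in> borel_measurable borel"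
    "w \<in> borel_measurable borel"
  shows "nconv (nconv u v) w = nconv u (nconv v w)"
proof
  fix x
  have "nconv (nconv u v) w x = (\<integral>\<^sup>+ y. (\<integral>\<^sup>+ z. u (x - y - z) * v z * w y \<partial>lborel) \<partial>lborel)"
    unfolding nconv_def by (simp add: nn_integral_multc)
  also have "\<dots> = (\<integral>\<^sup>+ y. (\<integral>\<^sup>+ z. u (x - z) * v (z - y) * w y \<partial>lborel) \<partial>lborel)"
  proof (rule nn_integral_cong)
    fix y :: real
    show "(\<integral>\<^sup>+ z. u (x - y - z) * v z * w y \<partial>lborel) = (\<integral>\<^sup>+ z. u (x - z) * v (z - y) * w y \<partial>lborel)"
      using nn_integral_translate[of "\<lambda>z. u (x - y - z) * v z * w y" y] by simp
  qed
  also have "\<dots> = (\<integral>\<^sup>+ z. (\<integral>\<^sup>+ y. u (x - z) * v (z - y) * w y \<partial>lborel) \<partial>lborel)"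
    by (rule lborel_pair.Fubini') measurable
  also have "\<dots> = nconv u (nconv v w) x"
    unfolding nconv_def by (simp add: nn_integral_cmult mult.assoc)
  finally show "nconv (nconv u v) w x = nconv u (nconv v w) x" .
qed

lemma nconv_mono:
  assumes "\<And>x. u x \<le> u' x" "\<And>x. v x \<le> v' x"
  shows "nconv u v x \<le> nconv u' v' x"
  unfolding nconv_def by (intro nn_integral_mono mult_mono assms) auto

lemma nconv_add_left:
  assumes [measurable]: "u \<in> borel_measurable borel" "u' \<in> borel_measurable borel"
    "v \<in> borel_measurable borel"
  shows "nconv (\<lambda>x. u x + u' x) v x = nconv u v x + nconv u' v x"
  unfolding nconv_def by (simp add: distrib_right nn_integral_add)

lemma nconv_add_right:
  assumes [measurable]: "u \<in> borel_measurable borel" "v \<in> borel_measurable borel"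
    "v' \<in> borel_measurable borel"
  shows "nconv u (\<lambda>x. v x + v' x) x = nconv u v x + nconv u v' x"
  unfolding nconv_def by (simp add: distrib_left nn_integral_add)

lemma nconv_cmult_left:
  assumes [measurable]: "u \<in> borel_measurable borel" "v \<in> borel_measurable borel"
  shows "nconv (\<lambda>x. c * u x) v x = c * nconv u v x"
  unfolding nconv_def by (simp add: mult.assoc nn_integral_cmult)

lemma nconv_le_bound:
  assumes [measurable]: "v \<in> borel_measurable borel" and "\<And>x. u x \<le> c"
  shows "nconv u v x \<le> c * (\<integral>\<^sup>+ y. v y \<partial>lborel)"
  unfolding nconv_def
  by (subst nn_integral_cmult[symmetric]) (auto intro!: nn_integral_mono mult_right_mono assms)

lemma nn_integral_nconv:
  assumes [measurable]: "u \<in> borel_measurable borel" "v \<in> borel_measurable borel"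
  shows "(\<integral>\<^sup>+ x. nconv u v x \<partial>lborel) = (\<integral>\<^sup>+ x. u x \<partial>lborel) * (\<integral>\<^sup>+ x. v x \<partial>lborel)"
proof -
  have "(\<integral>\<^sup>+ x. nconv u v x \<partial>lborel) = (\<integral>\<^sup>+ y. (\<integral>\<^sup>+ x. u (x - y) * v y \<partial>lborel) \<partial>lborel)"
    unfolding nconv_def by (rule lborel_pair.Fubini') measurable
  also have "\<dots> = (\<integral>\<^sup>+ y. (\<integral>\<^sup>+ x. u x \<partial>lborel) * v y \<partial>lborel)"
    by (simp add: nn_integral_multc nn_integral_translate)
  finally show ?thesis by (simp add: nn_integral_cmult)
qed

lemma nn_integral_nconv_power:
  assumes [measurable]: "u \<in> borel_measurable borel"
  shows "(\<integral>\<^sup>+ x. nconv_power u n x \<partial>lborel) = (\<integral>\<^sup>+ x. u x \<partial>lborel) ^ Suc n"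
  by (induction n) (simp_all add: nn_integral_nconv mult.commute)

text \<open>One factor is estimated by its supremum, the other n + 1 by their integrals.\<close>

lemma nconv_power_bound:
  assumes [measurable]: "u \<in> borel_measurable borel" and "\<And>x. u x \<le> c"
  shows "nconv_power u (Suc n) x \<le> c * (\<integral>\<^sup>+ y. u y \<partial>lborel) ^ Suc n"
proof -
  have "nconv_power u (Suc n) x = nconv u (nconv_power u n) x"
    by (simp add: nconv_commute)
  also have "\<dots> \<le> c * (\<integral>\<^sup>+ y. nconv_power u n y \<partial>lborel)"
    by (intro nconv_le_bound assms) measurable
  finally show ?thesis by (simp add: nn_integral_nconv_power)
qed

text \<open>The norm of a Wiener amalgam space, locally bounded and globally summable. The suprema
  are genuine and not essential ones, because direct Riemann integrability depends on every single
  value.\<close>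

definition amalgam_norm :: "(real \<Rightarrow> ennreal) \<Rightarrow> ennreal" where
  "amalgam_norm u = (\<integral>\<^sup>+ m. (SUP x\<in>{real_of_int m ..< real_of_int m + 1}. u x) \<partial>count_space UNIV)"

lemma le_cell_sup:
  fixes u :: "real \<Rightarrow> ennreal"
  shows "u x \<le> (SUP x\<in>{real_of_int \<lfloor>x\<rfloor> ..< real_of_int \<lfloor>x\<rfloor> + 1}. u x)"
  by (intro SUP_upper) auto

lemma le_amalgam_norm: "u x \<le> amalgam_norm u"
proof -
  let ?b = "\<lambda>m. (SUP x\<in>{real_of_int m ..< real_of_int m + 1}. u x)"
  have "u x \<le> ?b \<lfloor>x\<rfloor>" by (rule le_cell_sup)
  also have "\<dots> = (\<integral>\<^sup>+ m. ?b m * indicator {\<lfloor>x\<rfloor>} m \<partial>count_space UNIV)"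
    by (simp add: nn_integral_indicator_singleton)
  also have "\<dots> \<le> amalgam_norm u"
    unfolding amalgam_norm_def by (intro nn_integral_mono) (auto split: split_indicator)
  finally show ?thesis .
qed

lemma amalgam_norm_mono: "(\<And>x. u x \<le> v x) \<Longrightarrow> amalgam_norm u \<le> amalgam_norm v"
  unfolding amalgam_norm_def by (intro nn_integral_mono SUP_mono') auto

lemma amalgam_norm_cmult: "amalgam_norm (\<lambda>x. c * u x) = c * amalgam_norm u"
  unfolding amalgam_norm_def by (simp add: SUP_mult_left_ennreal[symmetric] nn_integral_cmult)

lemma amalgam_norm_suminf: "amalgam_norm (\<lambda>x. \<Sum>i. u i x) \<le> (\<Sum>i. amalgam_norm (u i))"
proof -
  let ?b = "\<lambda>i m. (SUP x\<in>{real_of_int m ..< real_of_int m + 1}. u i x)"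
  have "amalgam_norm (\<lambda>x. \<Sum>i. u i x) \<le> (\<integral>\<^sup>+ m. (\<Sum>i. ?b i m) \<partial>count_space UNIV)"
    unfolding amalgam_norm_def
    by (intro nn_integral_mono SUP_least suminf_le SUP_upper) auto
  also have "\<dots> = (\<Sum>i. amalgam_norm (u i))"
    unfolding amalgam_norm_def by (intro nn_integral_suminf) auto
  finally show ?thesis .
qed

lemma nn_integral_count_space_shift:
  "(\<integral>\<^sup>+ m. b (m + k) \<partial>count_space UNIV) = (\<integral>\<^sup>+ m. b m \<partial>count_space UNIV)" for k :: int
  by (rule nn_integral_bij_count_space)
    (auto simp: bij_betw_def inj_on_def image_iff intro: exI[of _ "_ - k"] diff_add_cancel[symmetric])

text \<open>For fixed y and x in [m, m + 1), the point x - y stays in two adjacent unit cells; hence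
  the factor 2. After Fubini, the sum over m of the cell suprema is unchanged by an integer shift of
  the cells.\<close>

lemma amalgam_norm_nconv:
  assumes [measurable]: "v \<in> borel_measurable borel"
  shows "amalgam_norm (nconv u v) \<le> 2 * amalgam_norm u * (\<integral>\<^sup>+ x. v x \<partial>lborel)"
proof -
  interpret ci: pair_sigma_finite "count_space (UNIV :: int set)" "lborel :: real measure"
    by (intro pair_sigma_finite.intro sigma_finite_measure_count_space sigma_finite_lborel)
  define b where "b m = (SUP x\<in>{real_of_int m ..< real_of_int m + 1}. u x)" for m
  have shift: "(\<integral>\<^sup>+ m. b (m + k) \<partial>count_space UNIV) = amalgam_norm u" for k
    using nn_integral_count_space_shift[of b k] by (simp add: b_def amalgam_norm_def)
  have "(SUP x\<in>{real_of_int m ..< real_of_int m + 1}. nconv u v x)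
      \<le> (\<integral>\<^sup>+ y. (b (m + \<lfloor>- y\<rfloor>) + b (m + \<lfloor>- y\<rfloor> + 1)) * v y \<partial>lborel)" for m
  proof (rule SUP_least)
    fix x assume x: "x \<in> {real_of_int m ..< real_of_int m + 1}"
    show "nconv u v x \<le> (\<integral>\<^sup>+ y. (b (m + \<lfloor>- y\<rfloor>) + b (m + \<lfloor>- y\<rfloor> + 1)) * v y \<partial>lborel)"
      unfolding nconv_def
    proof (intro nn_integral_mono mult_right_mono)
      fix y
      have "u (x - y) \<le> b \<lfloor>x - y\<rfloor>"
        unfolding b_def by (rule le_cell_sup)
      moreover have "\<lfloor>x - y\<rfloor> = m + \<lfloor>- y\<rfloor> \<or> \<lfloor>x - y\<rfloor> = m + \<lfloor>- y\<rfloor> + 1"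
        using x by (simp add: floor_eq_iff) linarith
      ultimately show "u (x - y) \<le> b (m + \<lfloor>- y\<rfloor>) + b (m + \<lfloor>- y\<rfloor> + 1)"
        by (auto intro: add_increasing add_increasing2)
    qed simp
  qed
  then have "amalgam_norm (nconv u v)
      \<le> (\<integral>\<^sup>+ m. (\<integral>\<^sup>+ y. (b (m + \<lfloor>- y\<rfloor>) + b (m + \<lfloor>- y\<rfloor> + 1)) * v y \<partial>lborel) \<partial>count_space UNIV)"
    unfolding amalgam_norm_def by (intro nn_integral_mono)
  also have "\<dots> = (\<integral>\<^sup>+ y. (\<integral>\<^sup>+ m. (b (m + \<lfloor>- y\<rfloor>) + b (m + \<lfloor>- y\<rfloor> + 1)) * v y \<partial>count_space UNIV) \<partial>lborel)"
    by (rule ci.Fubini'[symmetric]) (simp add: measurable_pair_measure_countable1)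
  also have "\<dots> = (\<integral>\<^sup>+ y. 2 * amalgam_norm u * v y \<partial>lborel)"
    using shift
    by (intro nn_integral_cong)
      (simp add: nn_integral_multc nn_integral_add add.assoc mult_2)
  finally show ?thesis by (simp add: nn_integral_cmult)
qed

subsection \<open>Weighted amalgam bounds for convolution powers\<close>

text \<open>The n + 2 factors \<open>a\<close> are exchanged for \<open>b\<close> one at a time.
  Each exchange costs a convolution with one factor \<open>d\<close>, whose other factors may be
  enlarged to \<open>a\<close>. This replaces the factorisation of a difference of powers, since
  subtraction is ill-behaved in \<open>ennreal\<close>.\<close>

lemma nconv_power_telescope:
  assumes [measurable]: "a \<in> borel_measurable borel" "b \<in> borel_measurable borel"
    "d \<in> borel_measurable borel" and a: "a = (\<lambda>x. b x + d x)"
  shows "nconv_power a (Suc n) x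
    \<le> nconv_power b (Suc n) x + of_nat (n + 2) * nconv d (nconv_power a n) x"
proof (induction n arbitrary: x)
  case 0
  have "nconv a a x = nconv b a x + nconv d a x"
    unfolding a by (subst (1) nconv_add_left) auto
  also have "nconv b a x = nconv b b x + nconv b d x"
    unfolding a by (rule nconv_add_right) auto
  also have "nconv b d x \<le> nconv a d x"
    by (rule nconv_mono) (auto simp: a)
  finally show ?case
    by (simp add: nconv_commute[of d a] add.assoc add_mono mult_2)
next
  case (Suc n)
  let ?A = "nconv_power a" and ?B = "nconv_power b"
  have le: "?B k y \<le> ?A k y" for k y
    by (induction k arbitrary: y) (auto simp: a intro!: nconv_mono)
  have "nconv (?A (Suc n)) a x
      \<le> nconv (\<lambda>x. ?B (Suc n) x + of_nat (n + 2) * nconv d (?A n) x) a x"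
    by (intro nconv_mono Suc.IH order_refl)
  also have "\<dots> = nconv (?B (Suc n)) a x + of_nat (n + 2) * nconv (nconv d (?A n)) a x"
    by (subst nconv_add_left) (simp_all add: nconv_cmult_left del: of_nat_add nconv_power.simps)
  also have "nconv (nconv d (?A n)) a = nconv d (?A (Suc n))"
    by (simp add: nconv_assoc)
  also have "nconv (?B (Suc n)) a x = ?B (Suc (Suc n)) x + nconv (?B (Suc n)) d x"
    by (subst (1) a, subst nconv_add_right) auto
  also have "nconv (?B (Suc n)) d x \<le> nconv (?A (Suc n)) d x"
    by (intro nconv_mono le) auto
  also have "\<dots> = nconv d (?A (Suc n)) x"
    by (subst nconv_commute) auto
  finally have "?A (Suc (Suc n)) x \<le> ?B (Suc (Suc n)) x + nconv d (?A (Suc n)) x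
      + of_nat (n + 2) * nconv d (?A (Suc n)) x"
    by (simp add: add_mono)
  then show ?case
    by (simp add: algebra_simps)
qed

text \<open>This weight is submultiplicative with constant 1 for every \<epsilon> \<ge> 0, which
  fails for 1 + |x|^\<epsilon> in general; the two weights are comparable up to constants.\<close>

definition pweight :: "real \<Rightarrow> real \<Rightarrow> ennreal" where
  "pweight \<epsilon> x = ennreal ((1 + \<bar>x\<bar>) powr \<epsilon>)"

lemma borel_measurable_pweight [measurable]: "pweight \<epsilon> \<in> borel_measurable borel"
  unfolding pweight_def[abs_def] by measurable

lemma pweight_submult:
  assumes "\<epsilon> \<ge> 0"
  shows "pweight \<epsilon> (x + y) \<le> pweight \<epsilon> x * pweight \<epsilon> y"
proof -
  have "1 + \<bar>x + y\<bar> \<le> (1 + \<bar>x\<bar>) * (1 + \<bar>y\<bar>)"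
    using abs_triangle_ineq[of x y] mult_nonneg_nonneg[OF abs_ge_zero[of x] abs_ge_zero[of y]]
    by (simp only: distrib_left distrib_right mult_1_left mult_1_right)
  then have "(1 + \<bar>x + y\<bar>) powr \<epsilon> \<le> (1 + \<bar>x\<bar>) powr \<epsilon> * (1 + \<bar>y\<bar>) powr \<epsilon>"
    using assms by (subst powr_mult[symmetric]) (auto intro!: powr_mono2)
  then show ?thesis
    by (simp add: pweight_def ennreal_mult[symmetric])
qed

text \<open>1 + |x + y| is at most twice the larger of 1 + |x| and 1 + |y|. The sum on the right
  lets the weight fall on a single factor of a convolution, whereas \<open>pweight_submult\<close>
  weights both.\<close>

lemma pweight_quasi_subadd:
  assumes "\<epsilon> \<ge> 0"
  shows "pweight \<epsilon> (x + y) \<le> ennreal (2 powr \<epsilon>) * (pweight \<epsilon> x + pweight \<epsilon> y)"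
proof -
  have "(1 + \<bar>x + y\<bar>) powr \<epsilon> \<le> (2 * max (1 + \<bar>x\<bar>) (1 + \<bar>y\<bar>)) powr \<epsilon>"
    using assms by (intro powr_mono2) (auto simp: max_def)
  also have "\<dots> = 2 powr \<epsilon> * max (1 + \<bar>x\<bar>) (1 + \<bar>y\<bar>) powr \<epsilon>"
    by (subst powr_mult) auto
  also have "\<dots> \<le> 2 powr \<epsilon> * ((1 + \<bar>x\<bar>) powr \<epsilon> + (1 + \<bar>y\<bar>) powr \<epsilon>)"
    by (intro mult_left_mono) (auto simp: max_def)
  finally show ?thesis
    by (simp add: pweight_def ennreal_mult[symmetric] ennreal_plus[symmetric] del: ennreal_plus)
qed

lemma pweight_nconv_le:
  assumes "\<epsilon> \<ge> 0" and [measurable]: "u \<in> borel_measurable borel" "v \<in> borel_measurable borel"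
  shows "pweight \<epsilon> x * nconv u v x \<le> nconv (\<lambda>x. pweight \<epsilon> x * u x) (\<lambda>x. pweight \<epsilon> x * v x) x"
proof -
  have "pweight \<epsilon> x * (u (x - y) * v y) \<le> pweight \<epsilon> (x - y) * u (x - y) * (pweight \<epsilon> y * v y)" for y
    using mult_right_mono[OF pweight_submult[OF assms(1), of "x - y" y], of "u (x - y) * v y"]
    by (simp add: mult_ac)
  then show ?thesis
    unfolding nconv_def by (subst nn_integral_cmult[symmetric]) (auto intro: nn_integral_mono)
qed

lemma pweight_nconv_le_add:
  assumes "\<epsilon> \<ge> 0" and [measurable]: "u \<in> borel_measurable borel" "v \<in> borel_measurable borel"
  shows "pweight \<epsilon> x * nconv u v x
    \<le> ennreal (2 powr \<epsilon>) * (nconv (\<lambda>x. pweight \<epsilon> x * u x) v x + nconv u (\<lambda>x. pweight \<epsilon> x * v x) x)"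
proof -
  have "pweight \<epsilon> x * (u (x - y) * v y) \<le> ennreal (2 powr \<epsilon>) *
      (pweight \<epsilon> (x - y) * u (x - y) * v y + u (x - y) * (pweight \<epsilon> y * v y))" for y
    using mult_right_mono[OF pweight_quasi_subadd[OF assms(1), of "x - y" y], of "u (x - y) * v y"]
    by (simp add: algebra_simps)
  then show ?thesis
    unfolding nconv_def
    by (simp add: nn_integral_cmult[symmetric] nn_integral_add[symmetric] nn_integral_mono)
qed

text \<open>Iterated quasi-subadditivity puts the weight on one factor, by commutativity always the
  same one. The other n + 1 factors stay unweighted, so an unweighted amalgam bound for them will
  suffice.\<close>

lemma pweight_nconv_power_le:
  assumes "\<epsilon> \<ge> 0" and [measurable]: "u \<in> borel_measurable borel"
  shows "\<exists>C<\<infinity>. \<forall>x. pweight \<epsilon> x * nconv_power u (Suc n) x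
    \<le> C * nconv (\<lambda>x. pweight \<epsilon> x * u x) (nconv_power u n) x"
proof (induction n)
  case 0
  have "pweight \<epsilon> x * nconv u u x \<le> (ennreal (2 powr \<epsilon>) * 2) * nconv (\<lambda>x. pweight \<epsilon> x * u x) u x" for x
    using pweight_nconv_le_add[OF assms(1,2,2), of x] nconv_commute[of u "\<lambda>x. pweight \<epsilon> x * u x"]
    by (simp add: mult_2[symmetric] mult.assoc)
  then show ?case
    by (intro exI[of _ "ennreal (2 powr \<epsilon>) * 2"]) (auto simp: ennreal_mult_less_top)
next
  case (Suc n)
  let ?P = "nconv_power u" and ?W = "\<lambda>x. pweight \<epsilon> x * u x"
  from Suc obtain C where C: "C < \<infinity>" "\<And>x. pweight \<epsilon> x * ?P (Suc n) x \<le> C * nconv ?W (?P n) x"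
    by blast
  have "pweight \<epsilon> x * ?P (Suc (Suc n)) x \<le> (ennreal (2 powr \<epsilon>) * (C + 1)) * nconv ?W (?P (Suc n)) x" for x
  proof -
    have "nconv (\<lambda>x. pweight \<epsilon> x * ?P (Suc n) x) u x \<le> nconv (\<lambda>x. C * nconv ?W (?P n) x) u x"
      by (intro nconv_mono C order_refl)
    also have "\<dots> = C * nconv ?W (?P (Suc n)) x"
      by (simp add: nconv_cmult_left nconv_assoc)
    finally have "nconv (\<lambda>x. pweight \<epsilon> x * ?P (Suc n) x) u x + nconv (?P (Suc n)) ?W x
        \<le> C * nconv ?W (?P (Suc n)) x + nconv ?W (?P (Suc n)) x"
      by (subst nconv_commute[of _ ?W]) (auto simp del: nconv_power.simps intro: add_right_mono)
    then have "ennreal (2 powr \<epsilon>) * (nconv (\<lambda>x. pweight \<epsilon> x * ?P (Suc n) x) u x + nconv (?P (Suc n)) ?W x)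
      \<le> ennreal (2 powr \<epsilon>) * (C * nconv ?W (?P (Suc n)) x + nconv ?W (?P (Suc n)) x)"
      by (rule mult_left_mono) simp
    with pweight_nconv_le_add[OF assms(1), of "?P (Suc n)" u x]
    show ?thesis
      by (simp add: algebra_simps)
  qed
  with C(1) show ?case
    by (intro exI[of _ "ennreal (2 powr \<epsilon>) * (C + 1)"]) (auto simp: ennreal_mult_less_top)
qed

text \<open>By submultiplicativity every factor can carry its own weight, and the integral of a
  convolution is the product of the integrals.\<close>

lemma nn_integral_pweight_nconv_power:
  assumes "\<epsilon> \<ge> 0" and [measurable]: "u \<in> borel_measurable borel"
  shows "(\<integral>\<^sup>+ x. pweight \<epsilon> x * nconv_power u n x \<partial>lborel) \<le> (\<integral>\<^sup>+ x. pweight \<epsilon> x * u x \<partial>lborel) ^ Suc n"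
proof -
  have "pweight \<epsilon> x * nconv_power u n x \<le> nconv_power (\<lambda>x. pweight \<epsilon> x * u x) n x" for x
  proof (induction n arbitrary: x)
    case (Suc n)
    have "pweight \<epsilon> x * nconv_power u (Suc n) x
        \<le> nconv (\<lambda>x. pweight \<epsilon> x * nconv_power u n x) (\<lambda>x. pweight \<epsilon> x * u x) x"
      using pweight_nconv_le[OF assms(1), of "nconv_power u n" u x] by simp
    also have "\<dots> \<le> nconv_power (\<lambda>x. pweight \<epsilon> x * u x) (Suc n) x"
      by (auto intro!: nconv_mono Suc)
    finally show ?case .
  qed simp
  then have "(\<integral>\<^sup>+ x. pweight \<epsilon> x * nconv_power u n x \<partial>lborel)
      \<le> (\<integral>\<^sup>+ x. nconv_power (\<lambda>x. pweight \<epsilon> x * u x) n x \<partial>lborel)"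
    by (rule nn_integral_mono)
  then show ?thesis
    by (subst (asm) nn_integral_nconv_power) auto
qed

section \<open>Tail estimates and the amalgam norm of high convolution powers\<close>

lemma nn_integral_tail_le:
  assumes "\<epsilon> \<ge> 0" and [measurable]: "u \<in> borel_measurable borel"
  shows "(\<integral>\<^sup>+ x. u x * indicator {x. real s \<le> \<bar>x\<bar>} x \<partial>lborel)
    \<le> ennreal ((1 + real s) powr - \<epsilon>) * (\<integral>\<^sup>+ x. pweight \<epsilon> x * u x \<partial>lborel)"
proof -
  \<comment> \<open>Markov's inequality: on the tail the weight is at least (1 +
    s)^\<epsilon>.\<close>
  have "u x * indicator {x. real s \<le> \<bar>x\<bar>} x
      \<le> ennreal ((1 + real s) powr - \<epsilon>) * (pweight \<epsilon> x * u x)" for x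
  proof (cases "real s \<le> \<bar>x\<bar>")
    case True
    have "1 = (1 + real s) powr - \<epsilon> * (1 + real s) powr \<epsilon>"
      by (simp add: powr_add[symmetric])
    also have "\<dots> \<le> (1 + real s) powr - \<epsilon> * (1 + \<bar>x\<bar>) powr \<epsilon>"
      using True assms by (intro mult_left_mono powr_mono2) auto
    finally have "1 \<le> ennreal ((1 + real s) powr - \<epsilon>) * pweight \<epsilon> x"
      unfolding pweight_def by (simp add: ennreal_mult[symmetric])
    from mult_right_mono[OF this, of "u x"] True show ?thesis
      by (simp add: mult.assoc)
  qed simp
  then show ?thesis
    by (subst nn_integral_cmult[symmetric]) (auto intro: nn_integral_mono)
qed

text \<open>The interval (-s - 1, s + 1) meets exactly the 2s + 2 unit cells with indices from -s -
  1 to s.\<close>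

lemma amalgam_norm_interval_le:
  assumes "\<And>x. u x \<le> c" "\<And>x. \<bar>x\<bar> \<ge> real (Suc s) \<Longrightarrow> u x = 0"
  shows "amalgam_norm u \<le> c * ennreal (2 * real s + 2)"
proof -
  have "(SUP x\<in>{real_of_int m ..< real_of_int m + 1}. u x) \<le> c * indicator {- int (Suc s)..int s} m" for m
  proof (rule SUP_least)
    fix x assume x: "x \<in> {real_of_int m ..< real_of_int m + 1}"
    show "u x \<le> c * indicator {- int (Suc s)..int s} m"
    proof (cases "m \<in> {- int (Suc s)..int s}")
      case False
      then have "m \<le> - int s - 2 \<or> m \<ge> int s + 1"
        by auto
      then have "real_of_int m \<le> - real s - 2 \<or> real_of_int m \<ge> real s + 1"
        by linarith
      then have "\<bar>x\<bar> \<ge> real (Suc s)"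
        using x by auto
      then show ?thesis using assms(2) by simp
    qed (simp add: assms)
  qed
  then have "amalgam_norm u \<le> (\<integral>\<^sup>+ m. c * indicator {- int (Suc s)..int s} m \<partial>count_space UNIV)"
    unfolding amalgam_norm_def by (rule nn_integral_mono)
  also have "\<dots> = c * ennreal (2 * real s + 2)"
    by (simp add: nn_integral_cmult_indicator ennreal_of_nat_eq_real_of_nat algebra_simps)
  finally show ?thesis .
qed

text \<open>The summands are never sorted by size. Instead the cut-off s is raised in unit steps:
  exchanging the tail \<open>T s\<close> for \<open>T (Suc s)\<close> costs the error
  \<open>E s\<close>, which has one factor on the shell \<open>D s\<close> and n + 1 factors on the
  tail \<open>T s\<close>. The shell has amalgam norm O(s + 1), the tails contribute O((1 +
  s)^(-\<epsilon>(n + 1))), and the product is summable.\<close>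

lemma amalgam_norm_nconv_power_finite:
  assumes [measurable]: "u \<in> borel_measurable borel" and bound: "\<And>x. u x \<le> c" and "c < \<infinity>"
    and eps: "\<epsilon> > 0" and moment: "(\<integral>\<^sup>+ x. pweight \<epsilon> x * u x \<partial>lborel) < \<infinity>"
    and n: "3 \<le> \<epsilon> * real (Suc n)"
  shows "amalgam_norm (nconv_power u (Suc n)) < \<infinity>"
proof -
  define T where "T s x = u x * indicator {x. real s \<le> \<bar>x\<bar>} x" for s x
  define D where "D s x = u x * indicator {x. real s \<le> \<bar>x\<bar> \<and> \<bar>x\<bar> < real (Suc s)} x" for s x
  define E where "E s x = of_nat (n + 2) * nconv (D s) (nconv_power (T s) n) x" for s x
  define q where "q s = (1 + real s) powr - \<epsilon>" for s :: nat
  define J where "J = (\<integral>\<^sup>+ x. pweight \<epsilon> x * u x \<partial>lborel)"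
  have [measurable]: "T s \<in> borel_measurable borel" "D s \<in> borel_measurable borel" for s
    unfolding T_def[abs_def] D_def[abs_def] by measurable
  have T_le: "T s x \<le> c" and D_le: "D s x \<le> c" for s x
    using bound[of x] by (auto simp: T_def D_def split: split_indicator)
  have T_0: "T 0 = u"
    by (auto simp: T_def)
  have T_Suc: "T s = (\<lambda>x. T (Suc s) x + D s x)" for s
    by (auto simp: T_def D_def fun_eq_iff split: split_indicator)
  have int_T: "(\<integral>\<^sup>+ x. T s x \<partial>lborel) ^ Suc n \<le> ennreal (q s ^ Suc n) * J ^ Suc n" for s
  proof -
    have "(\<integral>\<^sup>+ x. T s x \<partial>lborel) \<le> ennreal (q s) * J"
      unfolding T_def q_def J_def using eps by (intro nn_integral_tail_le) auto
    then have "(\<integral>\<^sup>+ x. T s x \<partial>lborel) ^ Suc n \<le> (ennreal (q s) * J) ^ Suc n"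
      by (rule power_mono) simp
    also have "\<dots> = ennreal (q s ^ Suc n) * J ^ Suc n"
      unfolding power_mult_distrib by (subst ennreal_power) (simp_all add: q_def)
    finally show ?thesis .
  qed
  \<comment> \<open>By assumption \<open>n\<close> the power of \<open>q s\<close> is at most (1 +
    s)^(-3). One power is used up by the 2s + 2 cells, and an inverse square remains.\<close>
  have q_le: "(2 * real s + 2) * q s ^ Suc n \<le> 2 * inverse (real (Suc s) ^ 2)" for s
  proof -
    have "q s ^ Suc n = (1 + real s) powr (- \<epsilon> * real (Suc n))"
      unfolding q_def by (subst powr_realpow[symmetric]) (simp_all add: powr_powr)
    also have "\<dots> \<le> (1 + real s) powr (-3)"
      using n by (intro powr_mono) auto
    also have "\<dots> = inverse (real (Suc s) ^ 3)"
      by (simp add: powr_minus add.commute)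
    finally have "(2 * real s + 2) * q s ^ Suc n \<le> (2 * real s + 2) * inverse (real (Suc s) ^ 3)"
      by (intro mult_left_mono) auto
    also have "\<dots> = 2 * inverse (real (Suc s) ^ 2)"
    proof -
      have "2 * real s + 2 = 2 * real (Suc s)" by simp
      then show ?thesis
        by (simp add: field_simps power2_eq_square power3_eq_cube del: of_nat_Suc)
    qed
    finally show ?thesis .
  qed
  \<comment> \<open>The same majorant controls the remainder of the telescope, which only has to
    tend to 0.\<close>
  have q_le': "q s ^ Suc n \<le> 2 * inverse (real (Suc s) ^ 2)" for s
  proof -
    have "0 \<le> q s ^ Suc n" by (simp add: q_def)
    then have "1 * q s ^ Suc n \<le> (2 * real s + 2) * q s ^ Suc n"
      by (intro mult_right_mono) auto
    with q_le[of s] show ?thesis by simp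
  qed
  have summ: "summable (\<lambda>s. 2 * inverse (real (Suc s) ^ 2))"
    using inverse_squares_sums by (intro summable_mult) (auto simp: sums_iff inverse_eq_divide)
  have JN: "J ^ Suc n < \<infinity>"
    using moment unfolding J_def by (simp add: power_less_top_ennreal del: power_Suc)

  have telescope: "nconv_power u (Suc n) x \<le> nconv_power (T S) (Suc n) x + (\<Sum>s<S. E s x)" for S x
  proof (induction S)
    case (Suc S)
    have "nconv_power (T S) (Suc n) x \<le> nconv_power (T (Suc S)) (Suc n) x + E S x"
      unfolding E_def by (intro nconv_power_telescope T_Suc) auto
    then have "nconv_power (T S) (Suc n) x + (\<Sum>s<S. E s x)
        \<le> nconv_power (T (Suc S)) (Suc n) x + E S x + (\<Sum>s<S. E s x)"
      by (rule add_right_mono)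
    with Suc have "nconv_power u (Suc n) x
        \<le> nconv_power (T (Suc S)) (Suc n) x + E S x + (\<Sum>s<S. E s x)"
      by (rule order_trans)
    then show ?case
      by (simp add: add_ac del: nconv_power.simps)
  qed (simp add: T_0)
  have "nconv_power u (Suc n) x \<le> (\<Sum>s. E s x)" for x
  proof -
    \<comment> \<open>\<open>r S\<close> bounds the convolution power of \<open>T S\<close>
      uniformly in the argument. It tends to 0, so the finite telescope turns into an infinite
      series.\<close>
    define r where "r S = (c * J ^ Suc n) * ennreal (2 * inverse (real (Suc S) ^ 2))" for S
    have "r \<longlonglongrightarrow> (c * J ^ Suc n) * ennreal 0"
      unfolding r_def using \<open>c < \<infinity>\<close> JN summable_LIMSEQ_zero[OF summ]
      by (intro ennreal_tendsto_cmult tendsto_ennrealI)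
        (auto simp: ennreal_mult_less_top simp del: power_Suc)
    then have lim: "(\<lambda>S. r S + (\<Sum>s. E s x)) \<longlonglongrightarrow> 0 + (\<Sum>s. E s x)"
      by (intro tendsto_add) auto
    have "nconv_power u (Suc n) x \<le> r S + (\<Sum>s. E s x)" for S
    proof -
      have "nconv_power (T S) (Suc n) x \<le> c * (\<integral>\<^sup>+ x. T S x \<partial>lborel) ^ Suc n"
        by (intro nconv_power_bound T_le) auto
      also have "\<dots> \<le> c * (ennreal (2 * inverse (real (Suc S) ^ 2)) * J ^ Suc n)"
        using q_le'[of S]
        by (intro mult_left_mono order_trans[OF int_T] mult_right_mono ennreal_leI) auto
      also have "\<dots> = r S"
        by (simp add: r_def mult_ac)
      finally show ?thesis
        by (intro order_trans[OF telescope[of x S]] add_mono sum_le_suminf) auto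
    qed
    with LIMSEQ_le_const[OF lim] show ?thesis by auto
  qed
  then have "amalgam_norm (nconv_power u (Suc n)) \<le> (\<Sum>s. amalgam_norm (E s))"
    by (intro order_trans[OF amalgam_norm_mono amalgam_norm_suminf])
  also have "\<dots> \<le> (\<Sum>s. (of_nat (n + 2) * 2 * c * J ^ Suc n) * ennreal (2 * inverse (real (Suc s) ^ 2)))"
  proof (intro suminf_le allI)
    fix s
    \<comment> \<open>The shell factor supplies the amalgam norm; the tail factors enter only
      through their integrals.\<close>
    have "amalgam_norm (E s) \<le> of_nat (n + 2) * (2 * amalgam_norm (D s) * (\<integral>\<^sup>+ x. T s x \<partial>lborel) ^ Suc n)"
      unfolding E_def amalgam_norm_cmult
      using amalgam_norm_nconv[of "nconv_power (T s) n" "D s"]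
      by (intro mult_left_mono) (auto simp: nn_integral_nconv_power)
    also have "\<dots> \<le> of_nat (n + 2) * (2 * (c * ennreal (2 * real s + 2)) * (ennreal (q s ^ Suc n) * J ^ Suc n))"
      by (intro mult_left_mono mult_mono int_T amalgam_norm_interval_le D_le) (auto simp: D_def)
    also have "\<dots> = (of_nat (n + 2) * 2 * c * J ^ Suc n) * ennreal ((2 * real s + 2) * q s ^ Suc n)"
    proof -
      have "ennreal ((2 * real s + 2) * q s ^ Suc n) = ennreal (2 * real s + 2) * ennreal (q s ^ Suc n)"
        by (intro ennreal_mult) (auto simp: q_def)
      then show ?thesis
        by (simp only: mult_ac)
    qed
    also have "\<dots> \<le> (of_nat (n + 2) * 2 * c * J ^ Suc n) * ennreal (2 * inverse (real (Suc s) ^ 2))"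
      by (intro mult_left_mono ennreal_leI q_le) auto
    finally show "amalgam_norm (E s)
      \<le> (of_nat (n + 2) * 2 * c * J ^ Suc n) * ennreal (2 * inverse (real (Suc s) ^ 2))" .
  qed auto
  also have "\<dots> < \<infinity>"
    using \<open>c < \<infinity>\<close> JN summ
    by (subst ennreal_suminf_cmult)
      (auto simp: ennreal_mult_less_top suminf_ennreal2 of_nat_less_top simp del: power_Suc)
  finally show ?thesis .
qed

text \<open>Of the n + 3 factors \<open>u\<close>, quasi-subadditivity weights one and leaves n + 2
  unweighted, whose amalgam norm is finite. Submultiplicativity then shares the weight with
  \<open>v\<close>, for which a finite moment is enough.\<close>

lemma amalgam_norm_pweight_finite:
  assumes [measurable]: "u \<in> borel_measurable borel" "v \<in> borel_measurable borel"
    and bound: "\<And>x. u x \<le> c" and "c < \<infinity>" and eps: "\<epsilon> > 0"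
    and u: "(\<integral>\<^sup>+ x. pweight \<epsilon> x * u x \<partial>lborel) < \<infinity>"
    and v: "(\<integral>\<^sup>+ x. pweight \<epsilon> x * v x \<partial>lborel) < \<infinity>"
    and n: "3 \<le> \<epsilon> * real (Suc n)"
  shows "amalgam_norm (\<lambda>x. pweight \<epsilon> x * nconv (nconv_power u (Suc (Suc n))) v x) < \<infinity>"
proof -
  define p where "p = nconv_power u (Suc (Suc n))"
  have [measurable]: "p \<in> borel_measurable borel"
    unfolding p_def by measurable
  obtain C where C: "C < \<infinity>"
    "\<And>x. pweight \<epsilon> x * p x \<le> C * nconv (\<lambda>x. pweight \<epsilon> x * u x) (nconv_power u (Suc n)) x"
    using pweight_nconv_power_le[of \<epsilon> u "Suc n"] eps unfolding p_def by auto
  have "amalgam_norm (\<lambda>x. pweight \<epsilon> x * p x)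
      \<le> amalgam_norm (\<lambda>x. C * nconv (nconv_power u (Suc n)) (\<lambda>x. pweight \<epsilon> x * u x) x)"
    using C(2) by (subst nconv_commute) (auto simp del: nconv_power.simps intro: amalgam_norm_mono)
  also have "\<dots> \<le> C * (2 * amalgam_norm (nconv_power u (Suc n)) * (\<integral>\<^sup>+ x. pweight \<epsilon> x * u x \<partial>lborel))"
    unfolding amalgam_norm_cmult by (intro mult_left_mono amalgam_norm_nconv) auto
  also have "\<dots> < \<infinity>"
    using C(1) u amalgam_norm_nconv_power_finite[OF assms(1) bound \<open>c < \<infinity>\<close> eps u n]
    by (auto simp: ennreal_mult_less_top simp del: nconv_power.simps)
  finally have fin: "amalgam_norm (\<lambda>x. pweight \<epsilon> x * p x) < \<infinity>" .
  have "amalgam_norm (\<lambda>x. pweight \<epsilon> x * nconv p v x)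
      \<le> amalgam_norm (nconv (\<lambda>x. pweight \<epsilon> x * p x) (\<lambda>x. pweight \<epsilon> x * v x))"
    using eps by (intro amalgam_norm_mono pweight_nconv_le) auto
  also have "\<dots> \<le> 2 * amalgam_norm (\<lambda>x. pweight \<epsilon> x * p x) * (\<integral>\<^sup>+ x. pweight \<epsilon> x * v x \<partial>lborel)"
    by (intro amalgam_norm_nconv) auto
  also have "\<dots> < \<infinity>"
    using fin v by (auto simp: ennreal_mult_less_top)
  finally show ?thesis
    unfolding p_def .
qed

subsection \<open>Signed convolution powers\<close>

lemma borel_measurable_conv_power [measurable]:
  assumes [measurable]: "f \<in> borel_measurable borel"
  shows "conv_power f k \<in> borel_measurable borel"
proof (induction k)
  case (Suc k)
  then show ?case by (cases k) simp_all
qed simp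

text \<open>Integrability is not assumed, because otherwise the Bochner integral is 0 by convention.
  Hence the bounds for \<open>conv_power\<close> below hold at every point, even where a defining
  integral diverges.\<close>

lemma ennreal_abs_integral_le: "ennreal \<bar>\<integral>x. h x \<partial>M\<bar> \<le> (\<integral>\<^sup>+ x. ennreal \<bar>h x\<bar> \<partial>M)"
  for h :: "'a \<Rightarrow> real"
proof (cases "integrable M h")
  case True
  from integral_norm_bound_ennreal[OF this] show ?thesis by simp
qed (simp add: not_integrable_integral_eq)

lemma ennreal_abs_integral_le_nconv:
  "ennreal \<bar>\<integral>y. g (x - y) * h y \<partial>lborel\<bar> \<le> nconv (\<lambda>x. ennreal \<bar>g x\<bar>) (\<lambda>x. ennreal \<bar>h x\<bar>) x"
  using ennreal_abs_integral_le[of lborel "\<lambda>y. g (x - y) * h y"]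
  by (simp add: nconv_def abs_mult ennreal_mult)

text \<open>The regrouping takes place among non-negative convolutions, so the bound holds for every
  x. The corresponding identity for signed powers is proved below almost everywhere.\<close>

lemma conv_power_abs_le:
  assumes [measurable]: "f \<in> borel_measurable borel"
  shows "ennreal \<bar>conv_power f (Suc i + Suc j) x\<bar>
    \<le> nconv (\<lambda>x. ennreal \<bar>conv_power f (Suc i) x\<bar>) (nconv_power (\<lambda>x. ennreal \<bar>f x\<bar>) j) x"
proof (induction j arbitrary: x)
  case 0
  show ?case
    using ennreal_abs_integral_le_nconv[of "conv_power f (Suc i)" x f] by simp
next
  case (Suc j)
  let ?F = "\<lambda>x. ennreal \<bar>f x\<bar>" and ?G = "\<lambda>x. ennreal \<bar>conv_power f (Suc i) x\<bar>"
  have "ennreal \<bar>conv_power f (Suc i + Suc (Suc j)) x\<bar>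
      \<le> nconv (\<lambda>x. ennreal \<bar>conv_power f (Suc i + Suc j) x\<bar>) ?F x"
    using ennreal_abs_integral_le_nconv[of "conv_power f (Suc i + Suc j)" x f] by simp
  also have "\<dots> \<le> nconv (nconv ?G (nconv_power ?F j)) ?F x"
    by (intro nconv_mono Suc.IH order_refl)
  also have "\<dots> = nconv ?G (nconv_power ?F (Suc j)) x"
    by (simp add: nconv_assoc)
  finally show ?case .
qed

lemma conv_power_abs_le_nconv_power:
  assumes [measurable]: "f \<in> borel_measurable borel"
  shows "ennreal \<bar>conv_power f (Suc j) x\<bar> \<le> nconv_power (\<lambda>x. ennreal \<bar>f x\<bar>) j x"
proof (cases j)
  case (Suc i)
  then show ?thesis
    using conv_power_abs_le[of f 0 i x]
    by (simp add: nconv_commute[of "\<lambda>x. ennreal \<bar>f x\<bar>" "nconv_power _ _"])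
qed simp

lemma integrable_conv_power:
  assumes f: "integrable lborel f"
  shows "integrable lborel (conv_power f (Suc j))"
proof (rule integrableI_bounded)
  have [measurable]: "f \<in> borel_measurable borel"
    using borel_measurable_integrable[OF f] by simp
  show "conv_power f (Suc j) \<in> borel_measurable lborel"
    by simp
  have "(\<integral>\<^sup>+ x. ennreal (norm (conv_power f (Suc j) x)) \<partial>lborel)
      \<le> (\<integral>\<^sup>+ x. nconv_power (\<lambda>x. ennreal \<bar>f x\<bar>) j x \<partial>lborel)"
    using conv_power_abs_le_nconv_power[of f j] by (intro nn_integral_mono) simp
  also have "\<dots> = (\<integral>\<^sup>+ x. ennreal \<bar>f x\<bar> \<partial>lborel) ^ Suc j"
    by (rule nn_integral_nconv_power) simp
  also have "\<dots> < \<infinity>"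
    using f by (simp add: power_less_top_ennreal integrable_iff_bounded del: power_Suc)
  finally show "(\<integral>\<^sup>+ x. ennreal (norm (conv_power f (Suc j) x)) \<partial>lborel) < \<infinity>" .
qed

lemma AE_reflect:
  fixes x :: real
  assumes "Measurable.pred borel P" "AE y in lborel. P y"
  shows "AE y in lborel. P (x - y)"
  using AE_borel_affine[of "-1" P x] assms by simp

text \<open>Fubini applies at every x where the double integral converges absolutely. This is almost
  every x, because the absolute double integral, integrated over x, is the product of the three L1
  norms.\<close>

lemma AE_integral_convolution_assoc:
  fixes g h f :: "real \<Rightarrow> real"
  assumes g: "integrable lborel g" and h: "integrable lborel h" and f: "integrable lborel f"
  shows "AE x in lborel. (\<integral>y. (\<integral>z. g (x - y - z) * h z \<partial>lborel) * f y \<partial>lborel)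
    = (\<integral>z. g (x - z) * (\<integral>y. h (z - y) * f y \<partial>lborel) \<partial>lborel)"
proof -
  have [measurable]: "g \<in> borel_measurable borel" "h \<in> borel_measurable borel" "f \<in> borel_measurable borel"
    using assms[THEN borel_measurable_integrable] by simp_all
  let ?a = "\<lambda>f x. ennreal \<bar>f x\<bar>"
  have "(\<integral>\<^sup>+ x. nconv (?a g) (nconv (?a h) (?a f)) x \<partial>lborel) < \<infinity>"
    using assms by (simp add: nn_integral_nconv integrable_iff_bounded ennreal_mult_less_top)
  then have "AE x in lborel. nconv (?a g) (nconv (?a h) (?a f)) x \<noteq> \<infinity>"
    by (intro nn_integral_PInf_AE) auto
  then show ?thesis
  proof eventually_elim
    case (elim x)
    have int: "integrable (lborel \<Otimes>\<^sub>M lborel) (\<lambda>(z, y). g (x - z) * h (z - y) * f y)"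
    proof (rule integrableI_bounded)
      have "(\<integral>\<^sup>+ p. ennreal (norm (case p of (z, y) \<Rightarrow> g (x - z) * h (z - y) * f y)) \<partial>(lborel \<Otimes>\<^sub>M lborel))
          = (\<integral>\<^sup>+ z. (\<integral>\<^sup>+ y. ennreal \<bar>g (x - z)\<bar> * (ennreal \<bar>h (z - y)\<bar> * ennreal \<bar>f y\<bar>) \<partial>lborel) \<partial>lborel)"
        by (subst lborel.nn_integral_fst[symmetric]) (auto simp: abs_mult ennreal_mult mult.assoc)
      also have "\<dots> = nconv (?a g) (nconv (?a h) (?a f)) x"
        unfolding nconv_def by (simp add: nn_integral_cmult)
      finally show "(\<integral>\<^sup>+ p. ennreal (norm (case p of (z, y) \<Rightarrow> g (x - z) * h (z - y) * f y)) \<partial>(lborel \<Otimes>\<^sub>M lborel)) < \<infinity>"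
        using elim by (simp add: less_top)
    qed measurable
    have shift: "(\<integral>z. g (x - y - z) * h z \<partial>lborel) = (\<integral>z. g (x - z) * h (z - y) \<partial>lborel)" for y
      using lborel_integral_real_affine[of 1 "\<lambda>z. g (x - y - z) * h z" "-y"] by simp
    have "(\<integral>y. (\<integral>z. g (x - y - z) * h z \<partial>lborel) * f y \<partial>lborel)
        = (\<integral>y. (\<integral>z. g (x - z) * h (z - y) * f y \<partial>lborel) \<partial>lborel)"
      by (simp add: shift)
    also have "\<dots> = (\<integral>z. (\<integral>y. g (x - z) * h (z - y) * f y \<partial>lborel) \<partial>lborel)"
      by (rule lborel_pair.Fubini_integral[OF int])
    finally show ?case
      by (simp add: mult.assoc)
  qed
qed

text \<open>\<open>conv_power\<close> appends one factor at a time, so regrouping it into two blocks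
  rests on associativity and inherits its exceptional null sets.\<close>

lemma AE_conv_power_add:
  assumes f: "integrable lborel f"
  shows "AE x in lborel. conv_power f (Suc i + Suc j) x
    = (\<integral>y. conv_power f (Suc i) (x - y) * conv_power f (Suc j) y \<partial>lborel)"
proof (induction j)
  case (Suc j)
  have [measurable]: "f \<in> borel_measurable borel"
    using borel_measurable_integrable[OF f] by simp
  have "AE x in lborel. (\<integral>y. (\<integral>z. conv_power f (Suc i) (x - y - z) * conv_power f (Suc j) z \<partial>lborel) * f y \<partial>lborel)
      = (\<integral>z. conv_power f (Suc i) (x - z) * (\<integral>y. conv_power f (Suc j) (z - y) * f y \<partial>lborel) \<partial>lborel)"
    by (intro AE_integral_convolution_assoc integrable_conv_power f)
  then show ?case
  proof eventually_elim
    case (elim x)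
    \<comment> \<open>The exceptional set of the induction hypothesis stays null under y \<mapsto> x
      - y, so the hypothesis may be inserted under the integral over y.\<close>
    have "AE y in lborel. conv_power f (Suc i + Suc j) (x - y)
        = (\<integral>z. conv_power f (Suc i) (x - y - z) * conv_power f (Suc j) z \<partial>lborel)"
      using Suc by (intro AE_reflect) measurable
    then have "conv_power f (Suc i + Suc (Suc j)) x
        = (\<integral>y. (\<integral>z. conv_power f (Suc i) (x - y - z) * conv_power f (Suc j) z \<partial>lborel) * f y \<partial>lborel)"
      by (auto intro!: integral_cong_AE)
    with elim show ?case by simp
  qed
qed simp

text \<open>A convolution integral ignores null sets, so almost-everywhere bounds on the factors
  become a bound at every x.\<close>

lemma nconv_mono_AE:
  assumes [measurable]: "u \<in> borel_measurable borel" "u' \<in> borel_measurable borel"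
    and "AE x in lborel. u x \<le> u' x" "AE x in lborel. v x \<le> v' x"
  shows "nconv u v x \<le> nconv u' v' x"
proof -
  have "AE y in lborel. u (x - y) \<le> u' (x - y)"
    using assms by (intro AE_reflect) auto
  with assms(4) have "AE y in lborel. u (x - y) * v y \<le> u' (x - y) * v' y"
    by eventually_elim (simp add: mult_mono)
  then show ?thesis
    unfolding nconv_def by (rule nn_integral_mono_AE)
qed

text \<open>The power is cut into n + 1 blocks of length i + 1, each dominated by
  \<open>H\<close>.\<close>

lemma AE_conv_power_mult_le:
  assumes f: "integrable lborel f" and [measurable]: "H \<in> borel_measurable borel"
    and H: "AE x in lborel. ennreal \<bar>conv_power f (Suc i) x\<bar> \<le> H x"
  shows "AE x in lborel. ennreal \<bar>conv_power f (Suc n * Suc i) x\<bar> \<le> nconv_power H n x"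
proof (induction n)
  case 0
  then show ?case using H by simp
next
  case (Suc n)
  have [measurable]: "f \<in> borel_measurable borel"
    using borel_measurable_integrable[OF f] by simp
  obtain k where k: "Suc n * Suc i = Suc k" by simp
  from AE_conv_power_add[OF f, of k i] show ?case
  proof eventually_elim
    case (elim x)
    have eq: "Suc (Suc n) * Suc i = Suc k + Suc i"
      using k by simp
    have "ennreal \<bar>conv_power f (Suc (Suc n) * Suc i) x\<bar>
        \<le> nconv (\<lambda>x. ennreal \<bar>conv_power f (Suc k) x\<bar>) (\<lambda>x. ennreal \<bar>conv_power f (Suc i) x\<bar>) x"
      unfolding eq elim by (rule ennreal_abs_integral_le_nconv)
    also have "\<dots> \<le> nconv (nconv_power H n) H x"
      using H Suc.IH[unfolded k] by (intro nconv_mono_AE) simp_all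
    finally show ?case by simp
  qed
qed

subsection \<open>Continuity of translation in the \<open>L\<^sup>1\<close> norm\<close>

definition L1_translation_continuous :: "(real \<Rightarrow> real) \<Rightarrow> bool" where
  "L1_translation_continuous f \<longleftrightarrow>
    ((\<lambda>t. \<integral>\<^sup>+ z. ennreal \<bar>f (t + z) - f z\<bar> \<partial>lborel) \<longlongrightarrow> 0) (at 0)"

lemma nn_integral_shift:
  fixes t :: real
  assumes [measurable]: "h \<in> borel_measurable borel"
  shows "(\<integral>\<^sup>+ z. h (t + z) \<partial>lborel) = (\<integral>\<^sup>+ z. h z \<partial>lborel)"
  using nn_integral_real_affine[of h 1 t] by simp

text \<open>Closedness in L1 by splitting the error into thirds; the distance between
  \<open>f\<close> and \<open>s\<close> is unchanged when both are translated.\<close>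

lemma L1_translation_continuous_approx:
  assumes [measurable]: "f \<in> borel_measurable borel"
    and approx: "\<And>e::real. e > 0 \<Longrightarrow> \<exists>s\<in>borel_measurable borel. L1_translation_continuous s \<and>
      (\<integral>\<^sup>+ z. ennreal \<bar>f z - s z\<bar> \<partial>lborel) < ennreal e"
  shows "L1_translation_continuous f"
  unfolding L1_translation_continuous_def
proof (rule order_tendstoI)
  fix e' :: ennreal assume "0 < e'"
  then have "\<exists>e>0. ennreal e < e'"
  proof (cases e')
    case (real r)
    with \<open>0 < e'\<close> show ?thesis by (intro exI[of _ "r / 2"]) (auto simp: ennreal_less_iff)
  qed (auto intro!: exI[of _ 1])
  then obtain e where e: "0 < e" "ennreal e < e'" by blast
  obtain s where [measurable]: "s \<in> borel_measurable borel" and s: "L1_translation_continuous s"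
    and d: "(\<integral>\<^sup>+ z. ennreal \<bar>f z - s z\<bar> \<partial>lborel) < ennreal (e / 3)"
    using approx[of "e / 3"] e by auto
  have "\<forall>\<^sub>F t in at 0. (\<integral>\<^sup>+ z. ennreal \<bar>s (t + z) - s z\<bar> \<partial>lborel) < ennreal (e / 3)"
    using s e unfolding L1_translation_continuous_def by (intro order_tendstoD(2)) auto
  then show "\<forall>\<^sub>F t in at 0. (\<integral>\<^sup>+ z. ennreal \<bar>f (t + z) - f z\<bar> \<partial>lborel) < e'"
  proof eventually_elim
    case (elim t)
    have "(\<integral>\<^sup>+ z. ennreal \<bar>f (t + z) - f z\<bar> \<partial>lborel)
        \<le> (\<integral>\<^sup>+ z. ennreal \<bar>f (t + z) - s (t + z)\<bar> + ennreal \<bar>s (t + z) - s z\<bar> + ennreal \<bar>f z - s z\<bar> \<partial>lborel)"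
      by (intro nn_integral_mono) (simp add: ennreal_plus[symmetric] ennreal_leI del: ennreal_plus)
    also have "\<dots> = (\<integral>\<^sup>+ z. ennreal \<bar>f z - s z\<bar> \<partial>lborel) + (\<integral>\<^sup>+ z. ennreal \<bar>s (t + z) - s z\<bar> \<partial>lborel)
        + (\<integral>\<^sup>+ z. ennreal \<bar>f z - s z\<bar> \<partial>lborel)"
      using nn_integral_shift[of "\<lambda>z. ennreal \<bar>f z - s z\<bar>" t] by (simp add: nn_integral_add)
    also have "\<dots> \<le> ennreal (e / 3) + ennreal (e / 3) + ennreal (e / 3)"
      using d elim by (intro add_mono) auto
    also have "\<dots> = ennreal e"
      using e by (simp add: ennreal_plus[symmetric] del: ennreal_plus)
    finally show ?case using e(2) by simp
  qed
qed simp

text \<open>A point of an open set stays in it under small translations, so the measure of U minus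
  its translate tends to 0 by dominated convergence. The reverse difference has the same measure,
  since U and its translate have equal finite measure.\<close>

lemma L1_translation_continuous_indicator_open:
  fixes U :: "real set"
  assumes "open U" "emeasure lborel U < \<infinity>"
  shows "L1_translation_continuous (indicator U)"
  unfolding L1_translation_continuous_def tendsto_at_iff_sequentially
proof (intro allI impI)
  fix t :: "nat \<Rightarrow> real" assume t: "t \<longlonglongrightarrow> 0"
  have [measurable]: "U \<in> sets borel" using assms by auto
  let ?V = "\<lambda>i. {z. t i + z \<in> U}"
  have V [measurable]: "?V i \<in> sets borel" for i by measurable
  have emV: "emeasure lborel (?V i) = emeasure lborel U" for i
    using nn_integral_shift[of "indicator U" "t i"]
    by (simp add: indicator_def[abs_def] nn_integral_indicator[symmetric])
  have "(\<lambda>i. \<integral>\<^sup>+ z. indicator (U - ?V i) z \<partial>lborel) \<longlonglongrightarrow> (\<integral>\<^sup>+ (z::real). 0 \<partial>lborel)"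
  proof (rule nn_integral_dominated_convergence[where w = "indicator U"])
    show "AE z in lborel. (\<lambda>i. indicator (U - ?V i) z) \<longlonglongrightarrow> (0::ennreal)"
    proof (intro AE_I2)
      fix z
      show "(\<lambda>i. indicator (U - ?V i) z) \<longlonglongrightarrow> (0::ennreal)"
      proof (cases "z \<in> U")
        case True
        have "(\<lambda>i. t i + z) \<longlonglongrightarrow> 0 + z"
          by (intro tendsto_add t tendsto_const)
        then have "\<forall>\<^sub>F i in sequentially. t i + z \<in> U"
          using assms True by (auto dest: topological_tendstoD)
        then have "\<forall>\<^sub>F i in sequentially. indicator (U - ?V i) z = (0::ennreal)"
          by eventually_elim simp
        then show ?thesis by (rule tendsto_eventually)
      qed simp
    qed
  qed (use assms in \<open>auto split: split_indicator\<close>)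
  then have lim: "(\<lambda>i. emeasure lborel (U - ?V i)) \<longlonglongrightarrow> 0"
    by simp
  have "(\<integral>\<^sup>+ z. ennreal \<bar>indicator U (t i + z) - indicator U z\<bar> \<partial>lborel) = 2 * emeasure lborel (U - ?V i)" for i
  proof -
    have fin: "emeasure lborel (?V i \<inter> U) < \<infinity>"
      using assms(2) by (rule le_less_trans[rotated]) (intro emeasure_mono, auto)
    have "emeasure lborel (U - ?V i) + emeasure lborel (?V i \<inter> U) = emeasure lborel U"
      by (subst plus_emeasure) (auto intro!: arg_cong2[of _ _ _ _ emeasure])
    moreover have "emeasure lborel (?V i - U) + emeasure lborel (?V i \<inter> U) = emeasure lborel (?V i)"
      by (subst plus_emeasure) (auto intro!: arg_cong2[of _ _ _ _ emeasure])
    ultimately have "emeasure lborel (?V i \<inter> U) + emeasure lborel (U - ?V i)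
        = emeasure lborel (?V i \<inter> U) + emeasure lborel (?V i - U)"
      using emV[of i] by (simp add: add.commute)
    with fin have "emeasure lborel (U - ?V i) = emeasure lborel (?V i - U)"
      by (subst (asm) ennreal_add_left_cancel) auto
    moreover have "(\<integral>\<^sup>+ z. ennreal \<bar>indicator U (t i + z) - indicator U z\<bar> \<partial>lborel)
        = (\<integral>\<^sup>+ z. indicator (U - ?V i) z + indicator (?V i - U) z \<partial>lborel)"
      by (intro nn_integral_cong) (auto split: split_indicator)
    ultimately show ?thesis
      by (simp add: nn_integral_add mult_2)
  qed
  moreover have "(\<lambda>i. 2 * emeasure lborel (U - ?V i)) \<longlonglongrightarrow> 2 * 0"
    by (intro ennreal_tendsto_cmult lim) auto
  ultimately show "((\<lambda>t. \<integral>\<^sup>+ z. ennreal \<bar>indicator U (t + z) - indicator U z\<bar> \<partial>lborel) \<circ> t) \<longlonglongrightarrow> 0"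
    by (simp add: o_def)
qed

text \<open>By outer regularity \<open>A\<close> is approximated in L1 by open supersets of finite
  measure.\<close>

lemma L1_translation_continuous_indicator:
  fixes A :: "real set"
  assumes A [measurable]: "A \<in> sets borel" and fin: "emeasure lborel A < \<infinity>"
  shows "L1_translation_continuous (indicator A)"
proof (rule L1_translation_continuous_approx)
  fix e :: real assume "e > 0"
  from outer_regular_lborel[OF A this] obtain U
    where U: "open U" "A \<subseteq> U" "emeasure lborel (U - A) < ennreal e" by metis
  then have [measurable]: "U \<in> sets borel" by auto
  have "emeasure lborel U = emeasure lborel A + emeasure lborel (U - A)"
    using U by (subst plus_emeasure) (auto intro!: arg_cong2[of _ _ _ _ emeasure])
  also have "\<dots> < \<infinity>"
    using fin U(3) by (auto simp: less_top[symmetric])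
  finally have "L1_translation_continuous (indicator U)"
    by (intro L1_translation_continuous_indicator_open U)
  moreover have "(\<integral>\<^sup>+ z. ennreal \<bar>indicator A z - indicator U z\<bar> \<partial>lborel) = (\<integral>\<^sup>+ z. indicator (U - A) z \<partial>lborel)"
    using U(2) by (intro nn_integral_cong) (auto split: split_indicator)
  ultimately show "\<exists>s\<in>borel_measurable borel. L1_translation_continuous s \<and>
      (\<integral>\<^sup>+ z. ennreal \<bar>indicator A z - s z\<bar> \<partial>lborel) < ennreal e"
    using U(3) by (intro bexI[of _ "indicator U"]) auto
qed simp

lemma L1_translation_continuous_integrable:
  assumes "integrable lborel f"
  shows "L1_translation_continuous f"
  using assms
proof (induction rule: integrable_induct)
  case (base A c)
  then have [measurable]: "A \<in> sets borel" by simp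
  have "((\<lambda>t. ennreal \<bar>c\<bar> * (\<integral>\<^sup>+ z. ennreal \<bar>indicator A (t + z) - indicator A z\<bar> \<partial>lborel)) \<longlongrightarrow> ennreal \<bar>c\<bar> * 0) (at 0)"
    using L1_translation_continuous_indicator[of A] base
    unfolding L1_translation_continuous_def by (intro ennreal_tendsto_cmult) auto
  then show ?case
    unfolding L1_translation_continuous_def
    by (simp add: nn_integral_cmult[symmetric] ennreal_mult[symmetric] abs_mult[symmetric] algebra_simps)
next
  case (add f g)
  have [measurable]: "f \<in> borel_measurable borel" "g \<in> borel_measurable borel"
    using add.hyps[THEN borel_measurable_integrable] by simp_all
  have lim: "((\<lambda>t. (\<integral>\<^sup>+ z. ennreal \<bar>f (t + z) - f z\<bar> \<partial>lborel) + (\<integral>\<^sup>+ z. ennreal \<bar>g (t + z) - g z\<bar> \<partial>lborel)) \<longlongrightarrow> 0 + 0) (at 0)"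
    using add unfolding L1_translation_continuous_def by (intro tendsto_add)
  have "(\<integral>\<^sup>+ z. ennreal \<bar>f (t + z) + g (t + z) - (f z + g z)\<bar> \<partial>lborel)
     \<le> (\<integral>\<^sup>+ z. ennreal \<bar>f (t + z) - f z\<bar> \<partial>lborel) + (\<integral>\<^sup>+ z. ennreal \<bar>g (t + z) - g z\<bar> \<partial>lborel)" for t
    by (subst nn_integral_add[symmetric])
      (auto intro!: nn_integral_mono simp: ennreal_plus[symmetric] simp del: ennreal_plus)
  then show ?case
    unfolding L1_translation_continuous_def
    by (intro tendsto_sandwich[OF _ _ tendsto_const lim[simplified]]) auto
next
  case (lim f s)
  have [measurable]: "f \<in> borel_measurable borel" "\<And>i. s i \<in> borel_measurable borel"
    using \<open>integrable lborel f\<close> \<open>\<And>i. integrable lborel (s i)\<close> borel_measurable_integrable by force+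
  show ?case
  proof (rule L1_translation_continuous_approx)
    fix e :: real assume "e > 0"
    \<comment> \<open>The majorant comes from \<open>integrable_induct\<close>, whose approximants
      satisfy |s i| \<le> 2 |f|.\<close>
    have "(\<lambda>i. \<integral>\<^sup>+ z. ennreal (norm (f z - s i z)) \<partial>lborel) \<longlonglongrightarrow> 0"
      using lim by (intro nn_integral_dominated_convergence_norm[where w = "\<lambda>x. 2 * norm (f x)"])
        (auto simp: integrable_iff_bounded ennreal_mult nn_integral_cmult ennreal_mult_less_top)
    then have "\<forall>\<^sub>F i in sequentially. (\<integral>\<^sup>+ z. ennreal (norm (f z - s i z)) \<partial>lborel) < ennreal e"
      using \<open>e > 0\<close> by (intro order_tendstoD(2)) auto
    then obtain i where "(\<integral>\<^sup>+ z. ennreal (norm (f z - s i z)) \<partial>lborel) < ennreal e"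
      by (auto dest: eventually_happens)
    then show "\<exists>s\<in>borel_measurable borel. L1_translation_continuous s \<and>
      (\<integral>\<^sup>+ z. ennreal \<bar>f z - s z\<bar> \<partial>lborel) < ennreal e"
      using lim.IH by (intro bexI[of _ "s i"]) auto
  qed simp
qed

text \<open>Reflection moves the variable x from the bounded factor to \<open>f\<close>. The
  increment over t is then at most \<open>B\<close> times the L1 distance between \<open>f\<close>
  and its translate by t.\<close>

lemma continuous_on_integral_convolution:
  fixes g f :: "real \<Rightarrow> real"
  assumes [measurable]: "g \<in> borel_measurable borel" and g: "\<And>x. \<bar>g x\<bar> \<le> B" and f: "integrable lborel f"
  shows "continuous_on UNIV (\<lambda>x. \<integral>y. g (x - y) * f y \<partial>lborel)"
proof -
  have [measurable]: "f \<in> borel_measurable borel"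
    using borel_measurable_integrable[OF f] by simp
  have "B \<ge> 0" using g[of 0] by linarith
  define F where "F x = (\<integral>y. g (x - y) * f y \<partial>lborel)" for x
  have F: "F x = (\<integral>y. g y * f (x - y) \<partial>lborel)" for x
    unfolding F_def using lborel_integral_real_affine[of "-1" "\<lambda>y. g (x - y) * f y" x] by simp
  have f_shift: "integrable lborel (\<lambda>y. f (x - y))" for x
    using lborel_integrable_real_affine[OF f, of "-1" x] by simp
  have int: "integrable lborel (\<lambda>y. g y * f (x - y))" for x
    using g \<open>B \<ge> 0\<close>
    by (intro Bochner_Integration.integrable_bound[OF integrable_mult_right[OF f_shift[of x], of B]])
      (auto simp: abs_mult intro!: mult_right_mono)
  have le: "ennreal \<bar>F (x + t) - F x\<bar> \<le> ennreal B * (\<integral>\<^sup>+ z. ennreal \<bar>f (t + z) - f z\<bar> \<partial>lborel)" for x t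
  proof -
    have "F (x + t) - F x = (\<integral>y. g y * f (x + t - y) - g y * f (x - y) \<partial>lborel)"
      unfolding F by (intro Bochner_Integration.integral_diff[symmetric] int)
    then have "ennreal \<bar>F (x + t) - F x\<bar> \<le> (\<integral>\<^sup>+ y. ennreal \<bar>g y * f (x + t - y) - g y * f (x - y)\<bar> \<partial>lborel)"
      by (simp add: ennreal_abs_integral_le)
    also have "\<dots> \<le> (\<integral>\<^sup>+ y. ennreal B * ennreal \<bar>f (t + (x - y)) - f (x - y)\<bar> \<partial>lborel)"
    proof (intro nn_integral_mono)
      fix y
      have "\<bar>g y * f (x + t - y) - g y * f (x - y)\<bar> = \<bar>g y\<bar> * \<bar>f (t + (x - y)) - f (x - y)\<bar>"
        by (simp add: abs_mult[symmetric] algebra_simps)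
      also have "\<dots> \<le> B * \<bar>f (t + (x - y)) - f (x - y)\<bar>"
        by (intro mult_right_mono g) auto
      finally show "ennreal \<bar>g y * f (x + t - y) - g y * f (x - y)\<bar>
          \<le> ennreal B * ennreal \<bar>f (t + (x - y)) - f (x - y)\<bar>"
        using \<open>B \<ge> 0\<close> by (simp add: ennreal_mult[symmetric] ennreal_leI)
    qed
    also have "\<dots> = (\<integral>\<^sup>+ z. ennreal B * ennreal \<bar>f (t + z) - f z\<bar> \<partial>lborel)"
      using nn_integral_reflect[of "\<lambda>z. ennreal B * ennreal \<bar>f (t + z) - f z\<bar>" x] by simp
    also have "\<dots> = ennreal B * (\<integral>\<^sup>+ z. ennreal \<bar>f (t + z) - f z\<bar> \<partial>lborel)"
      by (rule nn_integral_cmult) measurable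
    finally show ?thesis .
  qed
  have lim: "((\<lambda>t. ennreal B * (\<integral>\<^sup>+ z. ennreal \<bar>f (t + z) - f z\<bar> \<partial>lborel)) \<longlongrightarrow> ennreal B * 0) (at 0)"
    using L1_translation_continuous_integrable[OF f]
    unfolding L1_translation_continuous_def by (intro ennreal_tendsto_cmult) auto
  have "isCont F x" for x
  proof -
    have "((\<lambda>t. ennreal \<bar>F (x + t) - F x\<bar>) \<longlongrightarrow> 0) (at 0)"
      using le[of x] by (intro tendsto_sandwich[OF _ _ tendsto_const lim[simplified]]) (auto simp: add.commute)
    then have "((\<lambda>t. ennreal \<bar>F (x + t) - F x\<bar>) \<longlongrightarrow> ennreal 0) (at 0)"
      by simp
    then have "((\<lambda>t. \<bar>F (x + t) - F x\<bar>) \<longlongrightarrow> 0) (at 0)"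
      by (subst (asm) tendsto_ennreal_iff) auto
    then have "((\<lambda>t. F (x + t) - F x) \<longlongrightarrow> 0) (at 0)"
      by (simp add: tendsto_rabs_zero_iff)
    then show ?thesis
      by (subst isCont_iff) (subst (asm) LIM_zero_iff, simp)
  qed
  then show ?thesis
    unfolding F_def[abs_def] by (simp add: continuous_at_imp_continuous_on)
qed

subsection \<open>Direct Riemann integrability\<close>

text \<open>A Riemann sum is the integral of a step function; in this form dominated convergence
  applies as the mesh shrinks.\<close>

lemma nn_integral_cells:
  fixes c :: "int \<Rightarrow> ennreal" and \<delta> :: real
  assumes "\<delta> > 0"
  shows "(\<integral>\<^sup>+ m. ennreal \<delta> * c m \<partial>count_space UNIV) = (\<integral>\<^sup>+ x. c \<lfloor>x / \<delta>\<rfloor> \<partial>lborel)"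
proof -
  interpret ci: pair_sigma_finite "count_space (UNIV :: int set)" "lborel :: real measure"
    by (intro pair_sigma_finite.intro sigma_finite_measure_count_space sigma_finite_lborel)
  have cell: "\<lfloor>x / \<delta>\<rfloor> = m \<longleftrightarrow> x \<in> {real_of_int m * \<delta> ..< (real_of_int m + 1) * \<delta>}" for x m
    using assms by (auto simp: floor_eq_iff field_simps)
  have ind: "indicator {\<lfloor>x / \<delta>\<rfloor>} m = (indicator {real_of_int m * \<delta> ..< (real_of_int m + 1) * \<delta>} x :: ennreal)" for x m
    using cell[of x m] by (auto simp: indicator_def)
  have "(\<integral>\<^sup>+ x. c \<lfloor>x / \<delta>\<rfloor> \<partial>lborel)
      = (\<integral>\<^sup>+ x. (\<integral>\<^sup>+ m. c m * indicator {\<lfloor>x / \<delta>\<rfloor>} m \<partial>count_space UNIV) \<partial>lborel)"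
    by (simp add: nn_integral_indicator_singleton)
  also have "\<dots> = (\<integral>\<^sup>+ x. (\<integral>\<^sup>+ m. c m * indicator {real_of_int m * \<delta> ..< (real_of_int m + 1) * \<delta>} x \<partial>count_space UNIV) \<partial>lborel)"
    by (simp add: ind)
  also have "\<dots> = (\<integral>\<^sup>+ m. (\<integral>\<^sup>+ x. c m * indicator {real_of_int m * \<delta> ..< (real_of_int m + 1) * \<delta>} x \<partial>lborel) \<partial>count_space UNIV)"
    by (rule ci.Fubini') (simp add: measurable_pair_measure_countable1)
  also have "\<dots> = (\<integral>\<^sup>+ m. ennreal \<delta> * c m \<partial>count_space UNIV)"
    using assms by (intro nn_integral_cong)
      (simp add: nn_integral_cmult_indicator emeasure_lborel_Ico algebra_simps mult.commute)
  finally show ?thesis ..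
qed

text \<open>An error criterion inside \<open>ennreal\<close>. For e > L the lower bound collapses to
  0, which is harmless.\<close>

lemma tendsto_ennreal_approx:
  fixes L :: real
  assumes "\<And>e. e > 0 \<Longrightarrow> \<forall>\<^sub>F t in F. ennreal (L - e) \<le> h t \<and> h t \<le> ennreal (L + e)"
  shows "(h \<longlongrightarrow> ennreal L) F"
proof (rule order_tendstoI)
  fix a assume "a < ennreal L"
  moreover have "((\<lambda>e. ennreal (L - e)) \<longlongrightarrow> ennreal (L - 0)) (at_right 0)"
    by (intro tendsto_intros)
  ultimately have "\<forall>\<^sub>F e in at_right 0. a < ennreal (L - e)"
    by (intro order_tendstoD(1)) auto
  then have "\<forall>\<^sub>F e in at_right 0. a < ennreal (L - e) \<and> e > 0"
    using eventually_at_right_less[of "0::real"] by eventually_elim simp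
  then obtain e where "e > 0" "a < ennreal (L - e)"
    using eventually_happens'[OF trivial_limit_at_right_real] by blast
  with assms[of e] show "\<forall>\<^sub>F t in F. a < h t"
    by (auto elim!: eventually_mono)
next
  fix a assume "ennreal L < a"
  moreover have "((\<lambda>e. ennreal (L + e)) \<longlongrightarrow> ennreal (L + 0)) (at_right 0)"
    by (intro tendsto_intros)
  ultimately have "\<forall>\<^sub>F e in at_right 0. ennreal (L + e) < a"
    by (intro order_tendstoD(2)) auto
  then have "\<forall>\<^sub>F e in at_right 0. ennreal (L + e) < a \<and> e > 0"
    using eventually_at_right_less[of "0::real"] by eventually_elim simp
  then obtain e where "e > 0" "ennreal (L + e) < a"
    using eventually_happens'[OF trivial_limit_at_right_real] by blast
  with assms[of e] show "\<forall>\<^sub>F t in F. h t < a"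
    by (auto elim!: eventually_mono)
qed

text \<open>Upper and lower sums are integrals of step functions that converge pointwise to
  \<open>p\<close> by continuity. The finite amalgam norm yields an integrable majorant for all
  meshes below 1, so both sums converge to the integral of \<open>p\<close>.\<close>

lemma dRi_nonneg_of_amalgam_norm:
  assumes nonneg: "\<And>x. 0 \<le> p x" and cont: "continuous_on UNIV p"
    and fin: "amalgam_norm (\<lambda>x. ennreal (p x)) < \<infinity>"
  shows "dRi_nonneg p"
proof -
  define b where "b m = (SUP x\<in>{real_of_int m ..< real_of_int m + 1}. ennreal (p x))" for m
  \<comment> \<open>A mesh cell shorter than 1 that contains x lies within the unit cell of x and
    its two neighbours, so \<open>w\<close> majorises all the step functions.\<close>
  define w where "w x = b (\<lfloor>x\<rfloor> + -1) + b \<lfloor>x\<rfloor> + b (\<lfloor>x\<rfloor> + 1)" for x :: real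
  define C where "C \<delta> x = {real_of_int \<lfloor>x / \<delta>\<rfloor> * \<delta> ..< (real_of_int \<lfloor>x / \<delta>\<rfloor> + 1) * \<delta>}" for \<delta> x :: real
  have [measurable]: "w \<in> borel_measurable borel"
    unfolding w_def[abs_def] by measurable
  have shift: "(\<integral>\<^sup>+ m. b (m + k) \<partial>count_space UNIV) = amalgam_norm (\<lambda>x. ennreal (p x))" for k
    using nn_integral_count_space_shift[of b k] by (simp add: b_def amalgam_norm_def)
  have "(\<integral>\<^sup>+ x. w x \<partial>lborel) = (\<integral>\<^sup>+ m. b (m + -1) + b m + b (m + 1) \<partial>count_space UNIV)"
    using nn_integral_cells[of 1 "\<lambda>m. b (m + -1) + b m + b (m + 1)"] by (simp add: w_def)
  also have "\<dots> < \<infinity>"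
    using fin shift[of "-1"] shift[of 0] shift[of 1] by (simp add: nn_integral_add)
  finally have w_fin: "(\<integral>\<^sup>+ x. w x \<partial>lborel) < \<infinity>" .

  have C_self: "x \<in> C \<delta> x" and C_near: "y \<in> C \<delta> x \<Longrightarrow> \<bar>y - x\<bar> < \<delta>" if "\<delta> > 0" for x y \<delta>
  proof -
    have "real_of_int \<lfloor>x / \<delta>\<rfloor> * \<delta> \<le> x"
      by (subst pos_le_divide_eq[OF that, symmetric]) simp
    moreover have "x < (real_of_int \<lfloor>x / \<delta>\<rfloor> + 1) * \<delta>"
      by (subst pos_divide_less_eq[OF that, symmetric]) simp
    ultimately show "x \<in> C \<delta> x" "y \<in> C \<delta> x \<Longrightarrow> \<bar>y - x\<bar> < \<delta>"
      by (auto simp: C_def algebra_simps abs_less_iff)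
  qed
  have le_w: "(SUP y\<in>C \<delta> x. ennreal (p y)) \<le> w x" if "0 < \<delta>" "\<delta> < 1" for x \<delta>
  proof (rule SUP_least)
    fix y assume "y \<in> C \<delta> x"
    then have "\<bar>y - x\<bar> < 1" using C_near[of \<delta> y x] that by simp
    then have "\<lfloor>y\<rfloor> = \<lfloor>x\<rfloor> + -1 \<or> \<lfloor>y\<rfloor> = \<lfloor>x\<rfloor> \<or> \<lfloor>y\<rfloor> = \<lfloor>x\<rfloor> + 1"
      by linarith
    moreover have "ennreal (p y) \<le> b \<lfloor>y\<rfloor>"
      unfolding b_def by (rule le_cell_sup)
    moreover have "b m \<le> w x" if "m = \<lfloor>x\<rfloor> + -1 \<or> m = \<lfloor>x\<rfloor> \<or> m = \<lfloor>x\<rfloor> + 1" for m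
      using that unfolding w_def by (elim disjE) (simp_all add: add_increasing add_increasing2 add.assoc)
    ultimately show "ennreal (p y) \<le> w x"
      by (meson order_trans)
  qed

  have near: "\<forall>\<^sub>F \<delta> in at_right 0. \<forall>y\<in>C \<delta> x. \<bar>p y - p x\<bar> \<le> e" if "e > 0" for x e
  proof -
    from cont have "isCont p x" by (simp add: continuous_on_eq_continuous_at)
    then have "\<forall>e>0. \<exists>d>0. \<forall>y. \<bar>y - x\<bar> < d \<longrightarrow> \<bar>p y - p x\<bar> < e"
      by (simp add: continuous_at_eps_delta dist_real_def)
    with that obtain d where d: "d > 0" "\<forall>y. \<bar>y - x\<bar> < d \<longrightarrow> \<bar>p y - p x\<bar> < e"
      by metis
    have "\<forall>\<^sub>F \<delta> in at_right 0. \<delta> \<in> {0<..<d}"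
      using d by (intro eventually_at_right_real) auto
    then show ?thesis
    proof eventually_elim
      case (elim \<delta>)
      have "\<bar>p y - p x\<bar> \<le> e" if "y \<in> C \<delta> x" for y
        using C_near[OF _ that] elim d(2) by (auto intro: less_imp_le)
      then show ?case by blast
    qed
  qed
  have lim_sup: "((\<lambda>\<delta>. SUP y\<in>C \<delta> x. ennreal (p y)) \<longlongrightarrow> ennreal (p x)) (at_right 0)" for x
  proof (rule tendsto_ennreal_approx)
    fix e :: real assume "e > 0"
    from near[OF this, of x] eventually_at_right_less[of "0::real"]
    show "\<forall>\<^sub>F \<delta> in at_right 0. ennreal (p x - e) \<le> (SUP y\<in>C \<delta> x. ennreal (p y))
        \<and> (SUP y\<in>C \<delta> x. ennreal (p y)) \<le> ennreal (p x + e)"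
    proof eventually_elim
      case (elim \<delta>)
      then show ?case
        using C_self[of \<delta> x] \<open>e > 0\<close>
        by (intro conjI SUP_upper2[of x] SUP_least ennreal_leI) (auto simp: abs_le_iff)
    qed
  qed
  have lim_inf: "((\<lambda>\<delta>. INF y\<in>C \<delta> x. ennreal (p y)) \<longlongrightarrow> ennreal (p x)) (at_right 0)" for x
  proof (rule tendsto_ennreal_approx)
    fix e :: real assume "e > 0"
    from near[OF this, of x] eventually_at_right_less[of "0::real"]
    show "\<forall>\<^sub>F \<delta> in at_right 0. ennreal (p x - e) \<le> (INF y\<in>C \<delta> x. ennreal (p y))
        \<and> (INF y\<in>C \<delta> x. ennreal (p y)) \<le> ennreal (p x + e)"
    proof eventually_elim
      case (elim \<delta>)
      then have "p x - e \<le> p y" if "y \<in> C \<delta> x" for y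
        using that by (auto simp: abs_le_iff dest!: bspec[of _ _ y])
      with elim show ?case
        using C_self[of \<delta> x] \<open>e > 0\<close>
        by (intro conjI INF_lower2[of x] INF_greatest ennreal_leI) auto
    qed
  qed

  \<comment> \<open>Here \<open>c\<close> stands for the cell suprema or the cell infima, so that
    one argument serves both sums.\<close>
  have dct: "((\<lambda>\<delta>. \<integral>\<^sup>+ m. ennreal \<delta> * c \<delta> m \<partial>count_space UNIV) \<longlongrightarrow> (\<integral>\<^sup>+ x. ennreal (p x) \<partial>lborel)) (at_right 0)"
    if le: "\<And>\<delta> x. 0 < \<delta> \<Longrightarrow> \<delta> < 1 \<Longrightarrow> c \<delta> \<lfloor>x / \<delta>\<rfloor> \<le> w x"
      and lim: "\<And>x. ((\<lambda>\<delta>. c \<delta> \<lfloor>x / \<delta>\<rfloor>) \<longlongrightarrow> ennreal (p x)) (at_right 0)" for c :: "real \<Rightarrow> int \<Rightarrow> ennreal"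
  proof (rule tendsto_at_right_sequentially[where b = 1])
    fix S :: "nat \<Rightarrow> real"
    assume S: "\<And>n. 0 < S n" "\<And>n. S n < 1" "S \<longlonglongrightarrow> 0"
    have [measurable]: "p \<in> borel_measurable borel"
      using cont by (rule borel_measurable_continuous_onI)
    have "filterlim S (at_right 0) sequentially"
      using S by (intro filterlim_at_withinI) auto
    then have "(\<lambda>n. c (S n) \<lfloor>x / S n\<rfloor>) \<longlonglongrightarrow> ennreal (p x)" for x
      using lim by (rule filterlim_compose[rotated])
    then have "(\<lambda>n. \<integral>\<^sup>+ x. c (S n) \<lfloor>x / S n\<rfloor> \<partial>lborel) \<longlonglongrightarrow> (\<integral>\<^sup>+ x. ennreal (p x) \<partial>lborel)"
      using le S w_fin by (intro nn_integral_dominated_convergence[where w = w]) auto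
    then show "(\<lambda>n. \<integral>\<^sup>+ m. ennreal (S n) * c (S n) m \<partial>count_space UNIV) \<longlonglongrightarrow> (\<integral>\<^sup>+ x. ennreal (p x) \<partial>lborel)"
      using S by (simp add: nn_integral_cells)
  qed simp

  have "(\<integral>\<^sup>+ x. ennreal (p x) \<partial>lborel) \<le> (\<integral>\<^sup>+ x. w x \<partial>lborel)"
  proof (rule nn_integral_mono)
    fix x show "ennreal (p x) \<le> w x"
      using C_self[of "1/2" x] by (intro order_trans[OF SUP_upper le_w[of "1/2"]]) auto
  qed
  also note w_fin
  finally obtain L where L: "(\<integral>\<^sup>+ x. ennreal (p x) \<partial>lborel) = ennreal L"
    by (cases "\<integral>\<^sup>+ x. ennreal (p x) \<partial>lborel") auto
  have "(upper_riemann_sum p \<longlongrightarrow> ennreal L) (at_right 0)"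
    unfolding upper_riemann_sum_def[abs_def] L[symmetric]
    by (rule dct) (use le_w lim_sup in \<open>simp_all add: C_def\<close>)
  moreover have "(lower_riemann_sum p \<longlongrightarrow> ennreal L) (at_right 0)"
    unfolding lower_riemann_sum_def[abs_def] L[symmetric]
  proof (rule dct)
    fix \<delta> x :: real assume "0 < \<delta>" "\<delta> < 1"
    then show "(INF z\<in>{real_of_int \<lfloor>x / \<delta>\<rfloor> * \<delta>..<(real_of_int \<lfloor>x / \<delta>\<rfloor> + 1) * \<delta>}. ennreal (p z)) \<le> w x"
      using C_self[of \<delta> x] le_w[of \<delta> x]
      by (intro INF_lower2[of x] order_trans[OF _ le_w[of \<delta> x]] SUP_upper) (auto simp: C_def)
  qed (use lim_inf in \<open>simp add: C_def\<close>)
  ultimately show ?thesis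
    unfolding dRi_nonneg_def using nonneg by blast
qed

lemma dRi_of_amalgam_norm:
  assumes cont: "continuous_on UNIV g" and fin: "amalgam_norm (\<lambda>x. ennreal \<bar>g x\<bar>) < \<infinity>"
  shows "dRi g"
  unfolding dRi_def
proof (intro conjI dRi_nonneg_of_amalgam_norm)
  show "amalgam_norm (\<lambda>x. ennreal (max (g x) 0)) < \<infinity>" "amalgam_norm (\<lambda>x. ennreal (max (- g x) 0)) < \<infinity>"
    by (rule le_less_trans[OF amalgam_norm_mono fin], simp add: ennreal_leI)+
qed (auto intro!: continuous_intros cont)

lemma bounded_of_amalgam_norm:
  assumes "amalgam_norm (\<lambda>x. ennreal \<bar>g x\<bar>) < \<infinity>"
  obtains B where "\<And>x. \<bar>g x\<bar> \<le> B"
proof -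
  obtain B where B: "amalgam_norm (\<lambda>x. ennreal \<bar>g x\<bar>) = ennreal B" "B \<ge> 0"
    using assms by (cases "amalgam_norm (\<lambda>x. ennreal \<bar>g x\<bar>)") auto
  have "\<bar>g x\<bar> \<le> B" for x
    using le_amalgam_norm[of "\<lambda>x. ennreal \<bar>g x\<bar>" x] B by (simp add: ennreal_le_iff)
  then show ?thesis by (rule that)
qed

section \<open>Comparison of the two weights and assembly of the theorem\<close>

lemma nn_integral_pweight_finite:
  assumes "\<epsilon> > 0" and f: "integrable lborel f" and "integrable lborel (\<lambda>x. \<bar>x\<bar> powr \<epsilon> * \<bar>f x\<bar>)"
  shows "(\<integral>\<^sup>+ x. pweight \<epsilon> x * ennreal \<bar>f x\<bar> \<partial>lborel) < \<infinity>"
proof -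
  have "(1 + \<bar>x\<bar>) powr \<epsilon> \<le> 2 powr \<epsilon> * (1 + \<bar>x\<bar> powr \<epsilon>)" for x :: real
  proof -
    have "(1 + \<bar>x\<bar>) powr \<epsilon> \<le> (2 * max 1 \<bar>x\<bar>) powr \<epsilon>"
      using assms by (intro powr_mono2) auto
    also have "\<dots> = 2 powr \<epsilon> * max 1 \<bar>x\<bar> powr \<epsilon>"
      by (subst powr_mult) auto
    also have "\<dots> \<le> 2 powr \<epsilon> * (1 + \<bar>x\<bar> powr \<epsilon>)"
      by (intro mult_left_mono) (auto simp: max_def)
    finally show ?thesis .
  qed
  then have le: "(1 + \<bar>x\<bar>) powr \<epsilon> * \<bar>f x\<bar> \<le> 2 powr \<epsilon> * (1 + \<bar>x\<bar> powr \<epsilon>) * \<bar>f x\<bar>" for x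
    by (intro mult_right_mono) auto
  have "pweight \<epsilon> x * ennreal \<bar>f x\<bar> \<le> ennreal (norm (2 powr \<epsilon> * (\<bar>f x\<bar> + \<bar>x\<bar> powr \<epsilon> * \<bar>f x\<bar>)))" for x
    unfolding pweight_def using le[of x]
    by (subst ennreal_mult[symmetric]) (auto intro!: ennreal_leI simp: algebra_simps simp del: ennreal_plus)
  then have "(\<integral>\<^sup>+ x. pweight \<epsilon> x * ennreal \<bar>f x\<bar> \<partial>lborel)
      \<le> (\<integral>\<^sup>+ x. ennreal (norm (2 powr \<epsilon> * (\<bar>f x\<bar> + \<bar>x\<bar> powr \<epsilon> * \<bar>f x\<bar>))) \<partial>lborel)"
    by (rule nn_integral_mono)
  also have "\<dots> < \<infinity>"
  proof -
    have "integrable lborel (\<lambda>x. 2 powr \<epsilon> * (\<bar>f x\<bar> + \<bar>x\<bar> powr \<epsilon> * \<bar>f x\<bar>))"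
      using assms by (intro integrable_mult_right Bochner_Integration.integrable_add integrable_abs)
    then show ?thesis
      unfolding integrable_iff_bounded by blast
  qed
  finally show ?thesis .
qed

theorem theorem1p1:
  fixes f :: "real \<Rightarrow> real" and \<epsilon> :: real
  assumes f_meas: "f \<in> borel_measurable lborel"
    and f_int: "integrable lborel f"
    and k0: "\<exists>k0::nat. k0 \<ge> 1 \<and> (\<exists>C. AE x in lborel. \<bar>conv_power f k0 x\<bar> \<le> C)"
    and eps_pos: "\<epsilon> > 0"
    and moment: "integrable lborel (\<lambda>x. \<bar>x\<bar> powr \<epsilon> * \<bar>f x\<bar>)"
  shows "\<exists>k1::nat. k1 \<ge> 1 \<and> (\<forall>k\<ge>k1.
           bounded (range (\<lambda>x. (1 + \<bar>x\<bar> powr \<epsilon>) * conv_power f k x)) \<and>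
           continuous_on UNIV (\<lambda>x. (1 + \<bar>x\<bar> powr \<epsilon>) * conv_power f k x) \<and>
           dRi (\<lambda>x. (1 + \<bar>x\<bar> powr \<epsilon>) * conv_power f k x) \<and>
           bounded (range (conv_power f k)) \<and>
           continuous_on UNIV (conv_power f k) \<and>
           dRi (conv_power f k))"
proof -
  have [measurable]: "f \<in> borel_measurable borel"
    using f_meas by simp
  let ?F = "\<lambda>x. ennreal \<bar>f x\<bar>"
  from k0 obtain i C where C: "AE x in lborel. \<bar>conv_power f (Suc i) x\<bar> \<le> C"
    by (metis Suc_le_D One_nat_def)
  \<comment> \<open>The truncation is bounded at every point, as the amalgam estimate requires, and
    still dominates |f_(i+1)| almost everywhere. It never exceeds |f_(i+1)|, so it inherits a finite
    moment.\<close>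
  define H where "H x = ennreal (min \<bar>conv_power f (Suc i) x\<bar> (max C 0))" for x
  have [measurable]: "H \<in> borel_measurable borel"
    unfolding H_def[abs_def] by measurable
  have H: "AE x in lborel. ennreal \<bar>conv_power f (Suc i) x\<bar> \<le> H x"
    using C by eventually_elim (auto simp: H_def intro!: ennreal_leI)
  have H_bound: "H x \<le> ennreal (max C 0)" for x
    by (auto simp: H_def intro!: ennreal_leI)
  have F_moment: "(\<integral>\<^sup>+ x. pweight \<epsilon> x * ?F x \<partial>lborel) < \<infinity>"
    by (rule nn_integral_pweight_finite[OF eps_pos f_int moment])
  have F_power_moment: "(\<integral>\<^sup>+ x. pweight \<epsilon> x * nconv_power ?F j x \<partial>lborel) < \<infinity>" for j
    using F_moment eps_pos
    by (intro le_less_trans[OF nn_integral_pweight_nconv_power])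
      (auto simp: power_less_top_ennreal simp del: power_Suc)
  have H_moment: "(\<integral>\<^sup>+ x. pweight \<epsilon> x * H x \<partial>lborel) < \<infinity>"
  proof (rule le_less_trans[OF nn_integral_mono F_power_moment[of i]])
    fix x
    have "H x \<le> ennreal \<bar>conv_power f (Suc i) x\<bar>"
      unfolding H_def by (intro ennreal_leI) simp
    also have "\<dots> \<le> nconv_power ?F i x"
      by (intro conv_power_abs_le_nconv_power) simp
    finally show "pweight \<epsilon> x * H x \<le> pweight \<epsilon> x * nconv_power ?F i x"
      by (rule mult_left_mono) simp
  qed
  obtain n where "3 / \<epsilon> \<le> real n"
    using real_arch_simple by blast
  then have "3 / \<epsilon> \<le> real (Suc n)" by simp
  with eps_pos have n: "3 \<le> \<epsilon> * real (Suc n)"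
    by (simp add: pos_divide_le_eq mult.commute del: of_nat_Suc)
  \<comment> \<open>\<open>Suc K\<close> counts the factors f in n + 3 blocks of length i + 1, and n
    + 3 is the number of factors in \<open>amalgam_norm_pweight_finite\<close>.\<close>
  obtain K where K: "Suc (Suc (Suc n)) * Suc i = Suc K" by simp

  \<comment> \<open>At least one further factor f is kept, even for j = 0: the power of
    \<open>H\<close> dominates f_(K+1) only almost everywhere, and the additional convolution makes
    the bound hold at every point.\<close>
  have amalgam: "amalgam_norm (\<lambda>x. pweight \<epsilon> x * ennreal \<bar>conv_power f (Suc K + Suc j) x\<bar>) < \<infinity>" for j
  proof (rule le_less_trans[OF amalgam_norm_mono])
    fix x
    have "ennreal \<bar>conv_power f (Suc K + Suc j) x\<bar>
        \<le> nconv (\<lambda>x. ennreal \<bar>conv_power f (Suc K) x\<bar>) (nconv_power ?F j) x"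
      by (intro conv_power_abs_le) simp
    also have "\<dots> \<le> nconv (nconv_power H (Suc (Suc n))) (nconv_power ?F j) x"
      using AE_conv_power_mult_le[OF f_int _ H, of "Suc (Suc n)"] unfolding K
      by (intro nconv_mono_AE) auto
    finally show "pweight \<epsilon> x * ennreal \<bar>conv_power f (Suc K + Suc j) x\<bar>
        \<le> pweight \<epsilon> x * nconv (nconv_power H (Suc (Suc n))) (nconv_power ?F j) x"
      by (rule mult_left_mono) simp
    show "amalgam_norm (\<lambda>x. pweight \<epsilon> x * nconv (nconv_power H (Suc (Suc n))) (nconv_power ?F j) x) < \<infinity>"
      by (rule amalgam_norm_pweight_finite[OF _ _ H_bound _ eps_pos H_moment F_power_moment n]) auto
  qed
  have amalgam_w: "amalgam_norm (\<lambda>x. ennreal \<bar>(1 + \<bar>x\<bar> powr \<epsilon>) * conv_power f (Suc K + Suc j) x\<bar>) < \<infinity>" for j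
  proof (rule le_less_trans[OF amalgam_norm_mono])
    fix x
    \<comment> \<open>Both terms of 1 + |x|^\<epsilon> are at most (1 + |x|)^\<epsilon>, hence the
      factor 2.\<close>
    have "1 powr \<epsilon> \<le> (1 + \<bar>x\<bar>) powr \<epsilon>" "\<bar>x\<bar> powr \<epsilon> \<le> (1 + \<bar>x\<bar>) powr \<epsilon>"
      using eps_pos by (intro powr_mono2; simp)+
    then have "(1 + \<bar>x\<bar> powr \<epsilon>) * \<bar>conv_power f (Suc K + Suc j) x\<bar>
        \<le> 2 * (1 + \<bar>x\<bar>) powr \<epsilon> * \<bar>conv_power f (Suc K + Suc j) x\<bar>"
      by (intro mult_right_mono) auto
    then show "ennreal \<bar>(1 + \<bar>x\<bar> powr \<epsilon>) * conv_power f (Suc K + Suc j) x\<bar>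
        \<le> 2 * (pweight \<epsilon> x * ennreal \<bar>conv_power f (Suc K + Suc j) x\<bar>)"
      by (simp add: pweight_def abs_mult ennreal_mult[symmetric] ennreal_numeral[symmetric] ennreal_leI
          mult.assoc del: ennreal_numeral conv_power.simps)
    show "amalgam_norm (\<lambda>x. 2 * (pweight \<epsilon> x * ennreal \<bar>conv_power f (Suc K + Suc j) x\<bar>)) < \<infinity>"
      using amalgam[of j] by (auto simp: amalgam_norm_cmult ennreal_mult_less_top simp del: conv_power.simps)
  qed
  have amalgam_1: "amalgam_norm (\<lambda>x. ennreal \<bar>conv_power f (Suc K + Suc j) x\<bar>) < \<infinity>" for j
  proof (rule le_less_trans[OF amalgam_norm_mono amalgam_w[of j]])
    fix x
    have "1 * \<bar>conv_power f (Suc K + Suc j) x\<bar> \<le> (1 + \<bar>x\<bar> powr \<epsilon>) * \<bar>conv_power f (Suc K + Suc j) x\<bar>"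
      by (intro mult_right_mono) auto
    then show "ennreal \<bar>conv_power f (Suc K + Suc j) x\<bar> \<le> ennreal \<bar>(1 + \<bar>x\<bar> powr \<epsilon>) * conv_power f (Suc K + Suc j) x\<bar>"
      by (intro ennreal_leI) (simp add: abs_mult del: conv_power.simps)
  qed
  \<comment> \<open>The index moves up by one, because continuity of a power is derived from
    boundedness of the preceding one.\<close>
  have cont: "continuous_on UNIV (conv_power f (Suc K + Suc (Suc j)))" for j
  proof -
    obtain B where "\<And>x. \<bar>conv_power f (Suc K + Suc j) x\<bar> \<le> B"
      using bounded_of_amalgam_norm[OF amalgam_1] by blast
    with borel_measurable_conv_power[of f "Suc K + Suc j"] f_int
    have "continuous_on UNIV (\<lambda>x. \<integral>y. conv_power f (Suc K + Suc j) (x - y) * f y \<partial>lborel)"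
      by (intro continuous_on_integral_convolution) auto
    then show ?thesis
      by simp
  qed
  show ?thesis
  \<comment> \<open>The amalgam bounds are available from index K + 2 on and continuity from K + 3
    on, whence the witness.\<close>
  proof (intro exI[of _ "Suc K + 2"] conjI allI impI)
    fix k assume "Suc K + 2 \<le> k"
    then obtain j where j: "k = Suc K + Suc (Suc j)"
      by (auto dest!: le_Suc_ex)
    show cont_k: "continuous_on UNIV (conv_power f k)"
      unfolding j by (rule cont)
    show cont_w: "continuous_on UNIV (\<lambda>x. (1 + \<bar>x\<bar> powr \<epsilon>) * conv_power f k x)"
      using eps_pos by (intro continuous_intros continuous_on_powr' cont_k) auto
    show "dRi (conv_power f k)"
      using cont_k amalgam_1[of "Suc j"] unfolding j by (rule dRi_of_amalgam_norm)
    show "dRi (\<lambda>x. (1 + \<bar>x\<bar> powr \<epsilon>) * conv_power f k x)"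
      using cont_w amalgam_w[of "Suc j"] unfolding j by (rule dRi_of_amalgam_norm)
    show "bounded (range (conv_power f k))"
      using bounded_of_amalgam_norm[OF amalgam_1[of "Suc j"]] unfolding j
      by (metis boundedI rangeE real_norm_def)
    show "bounded (range (\<lambda>x. (1 + \<bar>x\<bar> powr \<epsilon>) * conv_power f k x))"
      using bounded_of_amalgam_norm[OF amalgam_w[of "Suc j"]] unfolding j
      by (metis (mono_tags, lifting) boundedI rangeE real_norm_def)
  qed simp
qed

end
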